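(* Let $\mathbf{P}$ be a dynamical property. Suppose that (a) $\mathcal{H}_{\mathbf{P}}$ is a $G_\delta$ in $\mathcal{H}$, (b) $\mathcal{S}_{\mathbf{P}}$ is a $G_\delta$ in $\mathcal{S}$, (c) $\mathcal{S}_{\mathbf{P}}$ contains a dense set of Cantor systems (i.e. the Cantor systems in $\mathcal{S}_{\mathbf{P}}$ are dense in $\mathcal{S}_{\mathbf{P}}$). Let $\mathbf{Q}\subseteq\mathbf{P}$ be a dynamical property. Then: (1) $\mathbf{Q}$ is generic in $\mathcal{H}_{\mathbf{P}}$ if and only if $\mathbf{Q}$ is generic in $\mathcal{S}_{\mathbf{P}}$. (2) If $\mathbf{Q}$ contains only Cantor systems, then $\mathbf{Q}$ is dense in $\mathcal{H}_{\mathbf{P}}$ if and only if $\mathbf{Q}$ is dense in $\mathcal{S}_{\mathbf{P}}$.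
   Context: A topological dynamical system is a pair $(X,T)$ with $X$ a nonempty compact metric space and $T$ a homeomorphism of $X$; it is a Cantor system if $X$ is homeomorphic to the Cantor set. Isomorphism means conjugacy by a homeomorphism. A dynamical property is a family of isomorphism classes of topological dynamical systems (equivalently, an isomorphism-invariant class of systems); $(X,T)\in\mathbf{P}$ means that the isomorphism class of $(X,T)$ is in $\mathbf{P}$. $K$ is the Cantor set with a fixed compatible metric $d$, and $\mathcal{H}=\mathrm{Homeo}(K)$ carries the complete metric $d(\varphi,\psi)=\max_{x\in K}\left(d(\varphi(x),\psi(x))+d(\varphi^{-1}(x),\psi^{-1}(x))\right)$. $Q=[0,1]^{\aleph_0}$ is the Hilbert cube, $Q^{\mathbb{Z}}$ has the product topology (compact metrizable), and $\sigma$ is the shift $(\sigma x)(i)=x(i+1)$. $\mathcal{S}$ is the set of all nonempty closed $\sigma$-invariant ($\sigma X=X$) subsets $X\subseteq Q^{\mathbb{Z}}$, with the Hausdorff metric; $X\in\mathcal{S}$ is identified with the system $(X,\sigma|_X)$. $\mathcal{H}_{\mathbf{P}}=\{\varphi\in\mathcal{H}:(K,\varphi)\in\mathbf{P}\}$ and $\mathcal{S}_{\mathbf{P}}=\{X\in\mathcal{S}:(X,\sigma|_X)\in\mathbf{P}\}$, and similarly for $\mathbf{Q}$. "$\mathbf{Q}$ is generic in $\mathcal{H}_{\mathbf{P}}$" means $\mathcal{H}_{\mathbf{Q}}$ is residual in $\mathcal{H}_{\mathbf{P}}$ (contains a dense $G_\delta$ subset of $\mathcal{H}_{\mathbf{P}}$),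 and "$\mathbf{Q}$ is dense in $\mathcal{H}_{\mathbf{P}}$" means $\mathcal{H}_{\mathbf{Q}}$ is dense in $\mathcal{H}_{\mathbf{P}}$; likewise with $\mathcal{S}$ in place of $\mathcal{H}$. *)

theory Defs
  imports "HOL-Analysis.Analysis"
begin

text \<open>
  A system is a topology together with a self-map. Only the values of the map on the
  space matter. Isomorphisms are topological, so a compact metric space enters only through its
  (compact metrizable) topology.
\<close>

definition is_tds :: "'a topology \<Rightarrow> ('a \<Rightarrow> 'a) \<Rightarrow> bool" where
  "is_tds X T \<longleftrightarrow> topspace X \<noteq> {} \<and> compact_space X \<and> metrizable_space X \<and> homeomorphic_map X X T"

definition tds_isomorphic ::
    "'a topology \<Rightarrow> ('a \<Rightarrow> 'a) \<Rightarrow> 'b topology \<Rightarrow> ('b \<Rightarrow> 'b) \<Rightarrow> bool" where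
  "tds_isomorphic X T Y S \<longleftrightarrow>
     (\<exists>h. homeomorphic_map X Y h \<and> (\<forall>x\<in>topspace X. h (T x) = S (h x)))"

text \<open>The Cantor set is \<open>{0,1}\<^sup>\<nat>\<close> with the product topology.\<close>

abbreviation cantor_space :: "(nat \<Rightarrow> bool) topology" where
  "cantor_space \<equiv> euclidean"

definition is_cantor :: "'a topology \<Rightarrow> bool" where
  "is_cantor X \<longleftrightarrow> X homeomorphic_space cantor_space"

text \<open>
  A class of systems cannot range over all types, so it is represented by its members carried by
  subsets of one fixed type, with arbitrary topologies on these subsets. The lemma
  \<open>tds_representable\<close> below shows that no isomorphism class is lost. A system over any other type
  has the property if its isomorphism class is represented in the given set.
\<close>

type_synonym point = "int \<Rightarrow> nat \<Rightarrow> real"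

type_synonym sys_class = "(point topology \<times> (point \<Rightarrow> point)) set"

definition dynamical_property :: "sys_class \<Rightarrow> bool" where
  "dynamical_property P \<longleftrightarrow>
     (\<forall>(X, T)\<in>P. is_tds X T) \<and>
     (\<forall>X T Y S. (X, T) \<in> P \<longrightarrow> is_tds Y S \<longrightarrow> tds_isomorphic X T Y S \<longrightarrow> (Y, S) \<in> P)"

definition has_property :: "'a topology \<Rightarrow> ('a \<Rightarrow> 'a) \<Rightarrow> sys_class \<Rightarrow> bool" where
  "has_property X T P \<longleftrightarrow> is_tds X T \<and> (\<exists>(Y, S)\<in>P. tds_isomorphic X T Y S)"

definition homeos :: "((nat \<Rightarrow> bool) \<Rightarrow> (nat \<Rightarrow> bool)) set" where
  "homeos = {\<phi>. homeomorphic_map cantor_space cantor_space \<phi>}"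

definition compatible_metric :: "((nat \<Rightarrow> bool) \<Rightarrow> (nat \<Rightarrow> bool) \<Rightarrow> real) \<Rightarrow> bool" where
  "compatible_metric d \<longleftrightarrow> Metric_space UNIV d \<and> Metric_space.mtopology UNIV d = cantor_space"

definition homeo_dist :: "((nat \<Rightarrow> bool) \<Rightarrow> (nat \<Rightarrow> bool) \<Rightarrow> real) \<Rightarrow>
    ((nat \<Rightarrow> bool) \<Rightarrow> (nat \<Rightarrow> bool)) \<Rightarrow> ((nat \<Rightarrow> bool) \<Rightarrow> (nat \<Rightarrow> bool)) \<Rightarrow> real" where
  "homeo_dist d \<phi> \<psi> = (SUP x. d (\<phi> x) (\<psi> x) + d (inv \<phi> x) (inv \<psi> x))"

definition homeo_topology ::
    "((nat \<Rightarrow> bool) \<Rightarrow> (nat \<Rightarrow> bool) \<Rightarrow> real) \<Rightarrow> ((nat \<Rightarrow> bool) \<Rightarrow> (nat \<Rightarrow> bool)) topology" where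
  "homeo_topology d = Metric_space.mtopology homeos (homeo_dist d)"

definition homeos_with :: "sys_class \<Rightarrow> ((nat \<Rightarrow> bool) \<Rightarrow> (nat \<Rightarrow> bool)) set" where
  "homeos_with P = {\<phi>\<in>homeos. has_property cantor_space \<phi> P}"

definition hilbert_cube :: "(nat \<Rightarrow> real) set" where
  "hilbert_cube = {x. \<forall>n. 0 \<le> x n \<and> x n \<le> 1}"

definition shift :: "point \<Rightarrow> point" where
  "shift x = (\<lambda>i. x (i + 1))"

definition subshifts :: "point set set" where
  "subshifts = {X. X \<noteq> {} \<and> closed X \<and> (\<forall>x\<in>X. \<forall>i. x i \<in> hilbert_cube) \<and> shift ` X = X}"

text \<open>
  The Hausdorff metric is taken with respect to the library metric on \<open>point\<close>, a bounded metric
  for the product topology. All compatible metrics on the compact space of two-sided sequences in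
  the Hilbert cube give the same topology on \<open>subshifts\<close>. The value 0 for empty arguments is a
  dummy: \<open>Metric_space\<close> asks for nonnegativity also outside the carrier.
\<close>

definition hausdorff_dist :: "'a::metric_space set \<Rightarrow> 'a set \<Rightarrow> real" where
  "hausdorff_dist A B =
     (if A = {} \<or> B = {} then 0
      else max (SUP a\<in>A. infdist a B) (SUP b\<in>B. infdist b A))"

definition subshift_topology :: "point set topology" where
  "subshift_topology = Metric_space.mtopology subshifts hausdorff_dist"

definition subshifts_with :: "sys_class \<Rightarrow> point set set" where
  "subshifts_with P = {X\<in>subshifts. has_property (top_of_set X) shift P}"

definition dense_in :: "'a topology \<Rightarrow> 'a set \<Rightarrow> bool" where
  "dense_in X A \<longleftrightarrow> A \<subseteq> topspace X \<and> X closure_of A = topspace X"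

definition residual_in :: "'a topology \<Rightarrow> 'a set \<Rightarrow> bool" where
  "residual_in X A \<longleftrightarrow> A \<subseteq> topspace X \<and> (\<exists>G\<subseteq>A. gdelta_in X G \<and> dense_in X G)"

lemma tds_isomorphic_sym:
  assumes T: "is_tds X T" and iso: "tds_isomorphic X T Y S"
  shows "tds_isomorphic Y S X T"
proof -
  obtain h where h: "homeomorphic_map X Y h" and c: "\<And>x. x \<in> topspace X \<Longrightarrow> h (T x) = S (h x)"
    using iso unfolding tds_isomorphic_def by blast
  obtain g where g: "homeomorphic_maps X Y h g"
    using h homeomorphic_map_maps by blast
  have TX: "T ` topspace X = topspace X"
    using T homeomorphic_imp_surjective_map unfolding is_tds_def by blast
  have "g (S y) = T (g y)" if y: "y \<in> topspace Y" for y
  proof -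
    have gy: "g y \<in> topspace X" and hg: "h (g y) = y"
      using g y unfolding homeomorphic_maps_def continuous_map_def by auto
    have "T (g y) \<in> topspace X" using TX gy by blast
    then have "g (h (T (g y))) = T (g y)"
      using g unfolding homeomorphic_maps_def by blast
    then show ?thesis using c[OF gy] hg by simp
  qed
  moreover have "homeomorphic_map Y X g"
    using g homeomorphic_maps_map by blast
  ultimately show ?thesis unfolding tds_isomorphic_def by blast
qed

lemma has_property_iff_mem:
  assumes "dynamical_property P"
  shows "has_property X T P \<longleftrightarrow> (X, T) \<in> P"
proof
  assume "has_property X T P"
  then obtain Y S where "is_tds X T" "(Y, S) \<in> P" "tds_isomorphic X T Y S"
    unfolding has_property_def by blast
  then show "(X, T) \<in> P"
    using assms tds_isomorphic_sym unfolding dynamical_property_def by blast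
next
  assume "(X, T) \<in> P"
  moreover have "tds_isomorphic X T X T"
    unfolding tds_isomorphic_def by (rule exI[of _ id]) auto
  ultimately show "has_property X T P"
    using assms unfolding dynamical_property_def has_property_def by blast
qed

lemma tds_transfer:
  assumes T: "is_tds X T" and h: "homeomorphic_map X Y h"
  shows "\<exists>S. is_tds Y S \<and> tds_isomorphic X T Y S"
proof -
  obtain g where g: "homeomorphic_maps X Y h g"
    using h homeomorphic_map_maps by blast
  have gm: "homeomorphic_map Y X g"
    using g homeomorphic_maps_map by blast
  have gh: "\<And>x. x \<in> topspace X \<Longrightarrow> g (h x) = x"
    using g unfolding homeomorphic_maps_def by blast
  have XY: "X homeomorphic_space Y"
    using g homeomorphic_space_def by blast
  have "homeomorphic_map Y Y (h \<circ> (T \<circ> g))"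
    using T gm h unfolding is_tds_def by (meson homeomorphic_map_compose)
  moreover have "topspace Y \<noteq> {}" "compact_space Y" "metrizable_space Y"
    using T homeomorphic_empty_space[OF XY] homeomorphic_compact_space[OF XY]
      homeomorphic_metrizable_space[OF XY]
    unfolding is_tds_def by simp_all
  ultimately have "is_tds Y (h \<circ> (T \<circ> g))"
    unfolding is_tds_def by blast
  moreover have "tds_isomorphic X T Y (h \<circ> (T \<circ> g))"
    unfolding tds_isomorphic_def using h gh by (intro exI[of _ h]) auto
  ultimately show ?thesis by blast
qed

text \<open>Every system, over any type, is isomorphic to one over \<open>point\<close>.\<close>

lemma tds_representable:
  assumes "is_tds X T"
  shows "\<exists>(Y :: point topology) S. is_tds Y S \<and> tds_isomorphic X T Y S"
proof -
  obtain M d where M: "Metric_space M d" and X: "X = Metric_space.mtopology M d"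
    using assms unfolding is_tds_def metrizable_space_def by blast
  interpret Metric_space M d by (rule M)
  have tsX: "topspace X = M" by (simp add: X)
  have cX: "compact_space mtopology" using assms unfolding is_tds_def X by simp
  have ne: "M \<noteq> {}" using assms tsX unfolding is_tds_def by simp
  have "mtotally_bounded M"
    using cX compactin_imp_mtotally_bounded unfolding compact_space_def by simp
  then have "\<forall>n. \<exists>K. finite K \<and> K \<subseteq> M \<and> M \<subseteq> (\<Union>x\<in>K. mball x (inverse (Suc n)))"
    unfolding mtotally_bounded_def by (meson inverse_Suc)
  then obtain K where K: "\<And>n. finite (K n)" "\<And>n. K n \<subseteq> M"
      "\<And>n. M \<subseteq> (\<Union>x\<in>K n. mball x (inverse (Suc n)))"
    by metis
  define D where "D = (\<Union>n. K n)"
  have D: "countable D" "D \<subseteq> M"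
    using K unfolding D_def by (auto intro: countable_finite)
  have approx: "\<exists>z\<in>D. d x z < e" if "x \<in> M" "e > 0" for x e
  proof -
    obtain n where n: "inverse (real (Suc n)) < e" using reals_Archimedean[OF \<open>e > 0\<close>] by blast
    obtain z where "z \<in> K n" "x \<in> mball z (inverse (Suc n))" using K(3) \<open>x \<in> M\<close> by blast
    then show ?thesis using n unfolding D_def by (auto simp: commute intro!: bexI[of _ z])
  qed
  have "D \<noteq> {}" using approx[of _ 1] ne by auto
  then obtain q :: "nat \<Rightarrow> 'a" where q: "range q = D"
    using range_from_nat_into[OF _ D(1)] by metis
  define f :: "'a \<Rightarrow> point" where "f = (\<lambda>x i n. d x (q n))"
  have qM: "q n \<in> M" for n using q D by blast
  have cd: "continuous_map mtopology euclideanreal (\<lambda>x. d x (q n))" for n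
  proof -
    have "\<bar>d a (q n) - d x (q n)\<bar> \<le> d a x" if "a \<in> M" "x \<in> M" for a x
      using mdist_reverse_triangle[OF that(1) qM that(2), of n] by (simp add: commute)
    then have "\<exists>\<delta>>0. \<forall>x. x \<in> M \<and> d a x < \<delta> \<longrightarrow> dist (d a (q n)) (d x (q n)) < e"
      if "a \<in> M" "e > 0" for a e
      unfolding dist_real_def using that by (meson le_less_trans)
    then show ?thesis
      using metric_continuous_map[OF Met_TC.Metric_space_axioms, of "\<lambda>x. d x (q n)"] by simp
  qed
  have "continuous_map mtopology euclidean (\<lambda>x n. d x (q n))"
    by (subst euclidean_product_topology[symmetric]) (simp add: continuous_map_componentwise_UNIV cd)
  then have cf: "continuous_map mtopology euclidean f"
    unfolding f_def
    by (subst euclidean_product_topology[symmetric]) (simp add: continuous_map_componentwise_UNIV)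
  have inj: "inj_on f M"
  proof
    fix x y assume xy: "x \<in> M" "y \<in> M" "f x = f y"
    then have eq: "d x (q n) = d y (q n)" for n
      unfolding f_def by meson
    have "d x y < e" if "e > 0" for e
    proof -
      obtain n where n: "d x (q n) < e/2"
        using approx[OF xy(1), of "e/2"] \<open>e > 0\<close> q by auto
      have "d x y \<le> d x (q n) + d y (q n)"
        using triangle'[OF xy(1) qM xy(2), of n] .
      then show ?thesis using eq[of n] n by simp
    qed
    then have "d x y \<le> 0" by (meson less_irrefl not_le)
    then show "x = y" using xy nonneg by (metis dual_order.antisym zero)
  qed
  have "embedding_map X euclidean f"
    using cX cf inj tsX unfolding X by (intro continuous_imp_embedding_map) auto
  then have "homeomorphic_map X (top_of_set (f ` M)) f"
    unfolding embedding_map_def tsX by simp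
  from tds_transfer[OF assms this] show ?thesis by blast
qed

lemma Metric_space_homeos:
  assumes "compatible_metric d"
  shows "Metric_space homeos (homeo_dist d)"
proof -
  interpret Metric_space UNIV d
    using assms unfolding compatible_metric_def by simp
  have "compactin mtopology UNIV"
  proof -
    have "(UNIV :: (nat \<Rightarrow> bool) set) = PiE UNIV (\<lambda>_. UNIV)" by auto
    then have "compactin (product_topology (\<lambda>_. euclidean) UNIV) (UNIV :: (nat \<Rightarrow> bool) set)"
      by (metis compactin_PiE compactin_euclidean_iff finite finite_imp_compact)
    then show ?thesis
      using assms unfolding compatible_metric_def euclidean_product_topology by simp
  qed
  then have "mbounded UNIV" by (rule compactin_imp_mbounded)
  then obtain B where B: "\<And>x y. d x y \<le> B"
    unfolding mbounded_alt by blast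
  have bdd: "bdd_above (range (\<lambda>x. d (\<phi> x) (\<psi> x) + d (inv \<phi> x) (inv \<psi> x)))" for \<phi> \<psi>
    by (rule bdd_aboveI[of _ "B + B"]) (use add_mono[OF B B] in blast)
  have up: "d (\<phi> x) (\<psi> x) + d (inv \<phi> x) (inv \<psi> x) \<le> homeo_dist d \<phi> \<psi>" for \<phi> \<psi> x
    unfolding homeo_dist_def by (rule cSUP_upper[OF _ bdd]) simp
  show ?thesis
  proof
    fix \<phi> \<psi> show "0 \<le> homeo_dist d \<phi> \<psi>"
      using up[of \<phi> undefined \<psi>] by (smt (verit) nonneg)
    show "homeo_dist d \<phi> \<psi> = homeo_dist d \<psi> \<phi>"
      unfolding homeo_dist_def by (simp add: commute)
  next
    fix \<phi> \<psi> 
    show "(homeo_dist d \<phi> \<psi> = 0) = (\<phi> = \<psi>)"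
    proof
      assume "homeo_dist d \<phi> \<psi> = 0"
      then have "d (\<phi> x) (\<psi> x) = 0" for x
        using up[of \<phi> x \<psi>] by (smt (verit) nonneg)
      then show "\<phi> = \<psi>" by (auto simp: fun_eq_iff)
    qed (simp add: homeo_dist_def)
  next
    fix \<phi> \<psi> \<theta>
    show "homeo_dist d \<phi> \<theta> \<le> homeo_dist d \<phi> \<psi> + homeo_dist d \<psi> \<theta>"
      unfolding homeo_dist_def[of d \<phi> \<theta>]
    proof (rule cSUP_least)
      fix x
      have "d (\<phi> x) (\<theta> x) \<le> d (\<phi> x) (\<psi> x) + d (\<psi> x) (\<theta> x)"
        "d (inv \<phi> x) (inv \<theta> x) \<le> d (inv \<phi> x) (inv \<psi> x) + d (inv \<psi> x) (inv \<theta> x)"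
        by (auto intro: triangle)
      then show "d (\<phi> x) (\<theta> x) + d (inv \<phi> x) (inv \<theta> x) \<le> homeo_dist d \<phi> \<psi> + homeo_dist d \<psi> \<theta>"
        using up[of \<phi> x \<psi>] up[of \<psi> x \<theta>] by linarith
    qed simp
  qed
qed

lemma dist_point_le: "dist (x :: point) y \<le> 2"
proof -
  have g: "(\<lambda>n. (1/2::real) ^ n) sums 2"
    using geometric_sums[of "1/2::real"] by simp
  have b: "(1/2) ^ n * min (dist (x (from_nat n)) (y (from_nat n))) 1 \<le> (1/2::real) ^ n" for n
    by (simp add: mult_left_le)
  have "summable (\<lambda>n. (1/2) ^ n * min (dist (x (from_nat n)) (y (from_nat n))) (1::real))"
    by (rule summable_comparison_test'[OF sums_summable[OF g], of 0]) (use b in auto)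
  then have "dist x y \<le> (\<Sum>n. (1/2::real) ^ n)"
    unfolding dist_fun_def[of x y] by (rule suminf_le[OF b _ sums_summable[OF g]])
  then show ?thesis using sums_unique[OF g] by simp
qed

lemma Metric_space_subshifts: "Metric_space subshifts hausdorff_dist"
proof -
  have bdd: "bdd_above ((\<lambda>a. infdist a B) ` A)" if "B \<noteq> {}" for A B :: "point set"
  proof (rule bdd_aboveI[of _ 2])
    fix r assume "r \<in> (\<lambda>a. infdist a B) ` A"
    then obtain a where "r = infdist a B" by blast
    moreover obtain b where "b \<in> B" using \<open>B \<noteq> {}\<close> by blast
    ultimately show "r \<le> 2" using infdist_le[of b B a] dist_point_le[of a b] by linarith
  qed
  have up: "infdist a B \<le> hausdorff_dist A B" if "a \<in> A" "B \<noteq> {}" for a and A B :: "point set"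
    unfolding hausdorff_dist_def using cSUP_upper[OF that(1) bdd[OF that(2)]] that by auto
  have comm: "hausdorff_dist A B = hausdorff_dist B A" for A B :: "point set"
    unfolding hausdorff_dist_def by (simp add: max.commute disj_commute)
  have half: "infdist a C \<le> hausdorff_dist A B + hausdorff_dist B C"
    if ne: "A \<noteq> {}" "B \<noteq> {}" "C \<noteq> {}" and a: "a \<in> A" for a and A B C :: "point set"
  proof -
    have "infdist a C - hausdorff_dist B C \<le> infdist a B"
      unfolding infdist_notempty[OF ne(2)]
    proof (rule cINF_greatest[OF ne(2)])
      fix b assume "b \<in> B"
      then show "infdist a C - hausdorff_dist B C \<le> dist a b"
        using up[of b B C] ne infdist_triangle[of a C b] by linarith
    qed
    then show ?thesis using up[OF a ne(2)] by linarith
  qed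
  have ne: "A \<noteq> {}" "closed A" if "A \<in> subshifts" for A
    using that unfolding subshifts_def by auto
  show ?thesis
  proof
    show "0 \<le> hausdorff_dist A B" for A B :: "point set"
    proof (cases "A = {} \<or> B = {}")
      case False
      then obtain a where "a \<in> A" by blast
      then show ?thesis using up[of a A B] False infdist_nonneg[of a B] by linarith
    qed (auto simp: hausdorff_dist_def)
    show "hausdorff_dist A B = hausdorff_dist B A" for A B :: "point set" by (rule comm)
  next
    fix A B assume A: "A \<in> subshifts" and B: "B \<in> subshifts"
    have sub: "C \<subseteq> D" if "C \<in> subshifts" "D \<in> subshifts" "hausdorff_dist C D = 0" for C D
    proof
      fix x assume "x \<in> C"
      then have "infdist x D = 0" using up[of x C D] ne that infdist_nonneg[of x D] by auto
      then show "x \<in> D" using ne[OF that(2)] in_closed_iff_infdist_zero by blast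
    qed
    have "hausdorff_dist A A = 0"
      unfolding hausdorff_dist_def using ne[OF A] by simp
    then show "(hausdorff_dist A B = 0) = (A = B)"
      using sub[OF A B] sub[OF B A] comm by auto
  next
    fix A B C assume "A \<in> subshifts" "B \<in> subshifts" "C \<in> subshifts"
    then have n: "A \<noteq> {}" "B \<noteq> {}" "C \<noteq> {}" using ne by auto
    show "hausdorff_dist A C \<le> hausdorff_dist A B + hausdorff_dist B C"
      unfolding hausdorff_dist_def[of A C]
      using half[OF n] half[OF n(3,2,1)] n comm[of A B] comm[of B C]
      by (auto intro!: max.boundedI cSUP_least) (metis add.commute)
  qed
qed

end

theory Submission
  imports Defs
begin

text \<open>
  Both hyperspaces are images of one Polish space under open maps. Let \<open>E\<close> be the set of all
  topological embeddings \<open>h\<close> of the Cantor set into the two-sided sequences in the Hilbert cube whose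
  image is a subshift, with the uniform metric. Such an \<open>h\<close> determines the subshift \<open>range h\<close>
  and the homeomorphism \<open>induced h\<close> of the Cantor set, that is \<open>h\<inverse> \<circ> shift \<circ> h\<close>, and \<open>h\<close>
  is an isomorphism between these two systems. So the embeddings whose homeomorphism has a given
  property are exactly those whose subshift has it (\<open>property_transfer\<close>), and the theorem reduces
  to transferring density and residuality along the two maps, restricted to the embeddings with
  property \<open>P\<close>.

  Both maps are continuous, and both are open onto their images. The map \<open>h \<mapsto> induced h\<close> is onto
  (\<open>every_homeo_induced\<close>) and open (\<open>induced_open\<close>): for \<open>\<psi>\<close> near \<open>induced h\<close>, the points
  \<open>h x\<close> are almost reproduced by the itineraries of \<open>\<psi>\<close> under the coordinate \<open>x \<mapsto> h x 0\<close>, and a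
  perturbation of this coordinate in high dimensions of the Hilbert cube makes it injective without
  moving it much. The map \<open>h \<mapsto> range h\<close> reaches exactly the Cantor subshifts. It is open
  (\<open>range_open\<close>) because a Cantor set \<open>Y\<close> that is Hausdorff close to \<open>range h\<close> splits into clopen
  pieces close to the images of the cylinders of some length; every nonempty clopen piece is again a
  Cantor set, so \<open>Y\<close> can be parametrized piece by piece, hence uniformly close to \<open>h\<close>.

  Density passes both ways along a continuous map that is open onto a dense subspace, as long as the
  target set lies in the image. Residuality pulls back along such maps by the Baire category theorem.
  It also pushes forward if the source is completely metrizable (\<open>residual_image\<close>), and this
  is where the \<open>G\<^sub>\<delta>\<close> condition on the homeomorphisms enters: it pulls back to a \<open>G\<^sub>\<delta>\<close> condition
  on embeddings, so that the space of embeddings with property \<open>P\<close> is completely metrizable.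
  The image of the second map is merely dense in the subshifts with property \<open>P\<close>, so
  \<open>residual_image\<close> allows for a dense image; in particular the Cantor subshifts turn out to be
  residual among them without a topological characterization of the Cantor set.
\<close>

section \<open>Category along open maps onto dense subspaces\<close>

lemma dense_in_superset:
  assumes S: "dense_in X S" and sub: "S \<subseteq> T" "T \<subseteq> topspace X"
  shows "dense_in X T"
proof -
  have "topspace X \<subseteq> X closure_of T"
    using closure_of_mono[OF sub(1), of X] S unfolding dense_in_def by simp
  then show ?thesis
    using sub(2) closure_of_subset_topspace[of X T] unfolding dense_in_def by (intro conjI subset_antisym)
qed

text \<open>
  The subspace \<open>f ` topspace A\<close> is only required to be dense in \<open>B\<close>, and openness refers to the
  subspace topology on it.
\<close>
locale dense_open_map =
  fixes A :: "'a topology" and B :: "'b topology" and f :: "'a \<Rightarrow> 'b"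
  assumes cont: "continuous_map A B f"
    and open_image: "openin A U \<Longrightarrow> \<exists>W. openin B W \<and> W \<inter> f ` topspace A = f ` U"
    and dense_image: "B closure_of (f ` topspace A) = topspace B"
begin

lemma image_sub: "f ` topspace A \<subseteq> topspace B"
  using cont by (simp add: continuous_map_image_subset_topspace)

lemma open_meets_image:
  assumes "openin B W" "W \<noteq> {}"
  obtains x where "x \<in> topspace A" "f x \<in> W"
  using dense_image assms unfolding dense_intersects_open by blast

lemma open_preimage: "openin B W \<Longrightarrow> openin A {x \<in> topspace A. f x \<in> W}"
  using cont by (rule openin_continuous_map_preimage)

text \<open>
  A nonempty open set of \<open>A\<close> has as image the trace of a nonempty open set of \<open>B\<close>, which meets every
  dense open set.
\<close>
lemma dense_preimage_open:
  assumes "openin B W" and "B closure_of W = topspace B"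
  shows "A closure_of {x \<in> topspace A. f x \<in> W} = topspace A"
  unfolding dense_intersects_open
proof (intro allI impI)
  fix V assume V: "openin A V \<and> V \<noteq> {}"
  then obtain T where T: "openin B T" "T \<inter> f ` topspace A = f ` V"
    using open_image[of V] by auto
  have "T \<noteq> {}" using T(2) V by blast
  then have "W \<inter> T \<noteq> {}"
    using assms(2) T(1) unfolding dense_intersects_open by blast
  moreover have "openin B (W \<inter> T)" by (rule openin_Int[OF assms(1) T(1)])
  ultimately obtain x where x: "x \<in> topspace A" "f x \<in> W \<inter> T"
    using open_meets_image by metis
  then have "f x \<in> f ` V" using T(2) by blast
  then obtain v where "v \<in> V" "f v \<in> W" using x(2) by (metis imageE IntD1)
  moreover have "V \<subseteq> topspace A" using V openin_subset by blast
  ultimately show "{x \<in> topspace A. f x \<in> W} \<inter> V \<noteq> {}" by blast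
qed

lemma dense_in_image:
  assumes "dense_in A D"
  shows "dense_in B (f ` D)"
proof -
  have "f ` D \<inter> T \<noteq> {}" if T: "openin B T" "T \<noteq> {}" for T
  proof -
    obtain x where "x \<in> topspace A" "f x \<in> T" using open_meets_image[OF T] by metis
    then have "{x \<in> topspace A. f x \<in> T} \<noteq> {}" by blast
    then have "D \<inter> {x \<in> topspace A. f x \<in> T} \<noteq> {}"
      using assms open_preimage[OF T(1)] unfolding dense_in_def dense_intersects_open by blast
    then show ?thesis by blast
  qed
  moreover have "f ` D \<subseteq> topspace B"
    using assms image_sub unfolding dense_in_def by blast
  ultimately show ?thesis unfolding dense_in_def dense_intersects_open by blast
qed

lemma dense_in_preimage:
  assumes C: "C \<subseteq> f ` topspace A"
  shows "dense_in A {x \<in> topspace A. f x \<in> C} \<longleftrightarrow> dense_in B C"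
proof
  assume "dense_in A {x \<in> topspace A. f x \<in> C}"
  then have "dense_in B (f ` {x \<in> topspace A. f x \<in> C})" by (rule dense_in_image)
  moreover have "f ` {x \<in> topspace A. f x \<in> C} = C" using C by blast
  ultimately show "dense_in B C" by simp
next
  assume d: "dense_in B C"
  have "{x \<in> topspace A. f x \<in> C} \<inter> V \<noteq> {}" if V: "openin A V" "V \<noteq> {}" for V
  proof -
    obtain T where T: "openin B T" "T \<inter> f ` topspace A = f ` V"
      using open_image[OF V(1)] by blast
    have "T \<noteq> {}" using T(2) V by blast
    then obtain y where "y \<in> C" "y \<in> T"
      using d T(1) unfolding dense_in_def dense_intersects_open by blast
    then have "y \<in> f ` V" using C T(2) by blast
    then show ?thesis using \<open>y \<in> C\<close> openin_subset[OF V(1)] by blast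
  qed
  then show "dense_in A {x \<in> topspace A. f x \<in> C}"
    unfolding dense_in_def dense_intersects_open by blast
qed

text \<open>
  Near a point outside the image of \<open>f\<close>, the open set \<open>snd p\<close> of \<open>B\<close> serves as a substitute for the image
  of the open set \<open>fst p\<close> of \<open>A\<close>.
\<close>
definition linked :: "'a set \<times> 'b set \<Rightarrow> bool" where
  "linked p \<longleftrightarrow> openin A (fst p) \<and> openin B (snd p) \<and> snd p \<inter> f ` topspace A \<subseteq> f ` fst p"

text \<open>
  The closure in the condition on \<open>fst q\<close> keeps limits of nested first components inside \<open>fst p\<close>
  and \<open>U\<close>.
\<close>
definition refines :: "'a set \<Rightarrow> 'a set \<times> 'b set \<Rightarrow> 'a set \<times> 'b set \<Rightarrow> bool" where
  "refines U p q \<longleftrightarrow>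
     openin A (fst q) \<and> openin B (snd q) \<and> snd q \<noteq> {} \<and> snd q \<inter> f ` topspace A \<subseteq> f ` fst q \<and>
     A closure_of fst q \<subseteq> fst p \<inter> U \<and> snd q \<subseteq> snd p"

text \<open>
  Density of the image gives a point of \<open>fst p\<close> with value in \<open>T\<close>, and density of \<open>U\<close> moves it into \<open>U\<close>;
  regularity then provides a neighbourhood with small closure. The predicate \<open>R\<close> stands for a bound
  on the diameter.
\<close>
lemma refinement_exists:
  assumes reg: "regular_space A" and p: "linked p"
    and U: "openin A U" "A closure_of U = topspace A"
    and small: "\<And>x. x \<in> topspace A \<Longrightarrow> \<exists>N. openin A N \<and> x \<in> N \<and> R N"
    and R_mono: "\<And>M N. R N \<Longrightarrow> M \<subseteq> N \<Longrightarrow> R M"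
    and T: "openin B T" "T \<noteq> {}" "T \<subseteq> snd p"
  shows "\<exists>q. refines U p q \<and> R (fst q) \<and> snd q \<subseteq> T"
proof -
  define V where "V = fst p \<inter> {x \<in> topspace A. f x \<in> T}"
  have V: "openin A V"
    using p open_preimage[OF T(1)] unfolding V_def linked_def by blast
  obtain y where y: "y \<in> topspace A" "f y \<in> T" using open_meets_image[OF T(1,2)] by metis
  then have "f y \<in> f ` fst p" using T(3) p unfolding linked_def by blast
  then obtain z where z: "z \<in> fst p" "f z \<in> T" using y(2) by (metis imageE)
  moreover have "fst p \<subseteq> topspace A" using p openin_subset unfolding linked_def by metis
  ultimately have "V \<noteq> {}" unfolding V_def by blast
  then obtain x where x: "x \<in> U" "x \<in> V"
    using U V unfolding dense_intersects_open by blast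
  have xA: "x \<in> topspace A" using x(1) U(1) openin_subset by blast
  obtain N where N: "openin A N" "x \<in> N" "R N" using small[OF xA] by blast
  have "openin A (U \<inter> V \<inter> N)" by (intro openin_Int U(1) V N(1))
  moreover have "x \<in> U \<inter> V \<inter> N" using x N(2) by blast
  ultimately obtain V' K where V': "openin A V'" "x \<in> V'" "closedin A K" "V' \<subseteq> K" "K \<subseteq> U \<inter> V \<inter> N"
    using reg unfolding neighbourhood_base_of_closedin[symmetric] neighbourhood_base_of by meson
  then have V'cl': "A closure_of V' \<subseteq> U \<inter> V \<inter> N" by (meson closure_of_minimal subset_trans)
  obtain W where W: "openin B W" "W \<inter> f ` topspace A = f ` V'" using open_image[OF V'(1)] by blast
  have V'cl: "V' \<subseteq> A closure_of V'" using V'(1) by (simp add: closure_of_subset openin_subset)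
  have "f x \<in> W \<inter> T"
    using W(2) V'(2) x(2) xA unfolding V_def by blast
  then have "refines U p (V', W \<inter> T)"
    using V'(1) V'cl' W T unfolding refines_def V_def by auto
  moreover have "R V'" using R_mono[OF N(3)] V'cl V'cl' by blast
  ultimately show ?thesis by (intro exI[of _ "(V', W \<inter> T)"]) auto
qed

text \<open>
  Zorn's lemma gives a maximal family of refinements with disjoint second components. By
  maximality, every nonempty open subset of \<open>snd p\<close> meets one of its members. Disjointness will guarantee that a
  point of \<open>B\<close> lies in at most one branch of the tree of refinements.
\<close>
lemma disjoint_refinement:
  assumes ex: "\<And>T. openin B T \<Longrightarrow> T \<noteq> {} \<Longrightarrow> T \<subseteq> snd p \<Longrightarrow> \<exists>q. r q \<and> snd q \<subseteq> T"
    and r: "\<And>q. r q \<Longrightarrow> openin B (snd q) \<and> snd q \<noteq> {}"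
  shows "\<exists>F. (\<forall>q\<in>F. r q) \<and> (\<forall>q\<in>F. \<forall>q'\<in>F. q \<noteq> q' \<longrightarrow> snd q \<inter> snd q' = {}) \<and>
            (\<forall>T. openin B T \<longrightarrow> T \<noteq> {} \<longrightarrow> T \<subseteq> snd p \<longrightarrow> (\<exists>q\<in>F. snd q \<inter> T \<noteq> {}))"
proof -
  define \<A> where
    "\<A> = {F. (\<forall>q\<in>F. r q) \<and> (\<forall>q\<in>F. \<forall>q'\<in>F. q \<noteq> q' \<longrightarrow> snd q \<inter> snd q' = {})}"
  have "\<exists>M\<in>\<A>. \<forall>X\<in>\<A>. M \<subseteq> X \<longrightarrow> X = M"
  proof (rule subset_Zorn_nonempty)
    have "{} \<in> \<A>" unfolding \<A>_def by blast
    then show "\<A> \<noteq> {}" by blast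
    fix \<C> assume ch: "subset.chain \<A> \<C>"
    have sub: "\<C> \<subseteq> \<A>" and tot: "\<And>X Y. X \<in> \<C> \<Longrightarrow> Y \<in> \<C> \<Longrightarrow> X \<subseteq> Y \<or> Y \<subseteq> X"
      using ch unfolding subset_chain_def by auto
    have "snd q \<inter> snd q' = {}" if qq: "q \<in> \<Union>\<C>" "q' \<in> \<Union>\<C>" "q \<noteq> q'" for q q'
    proof -
      obtain X where "X \<in> \<C>" "q \<in> X" "q' \<in> X" using qq(1,2) tot by blast
      then show ?thesis using sub qq(3) unfolding \<A>_def by blast
    qed
    then show "\<Union>\<C> \<in> \<A>" using sub unfolding \<A>_def by blast
  qed
  then obtain F where F: "F \<in> \<A>" and mx: "\<And>X. X \<in> \<A> \<Longrightarrow> F \<subseteq> X \<Longrightarrow> X = F" by blast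
  have "\<exists>q\<in>F. snd q \<inter> T \<noteq> {}" if T: "openin B T" "T \<noteq> {}" "T \<subseteq> snd p" for T
  proof (rule ccontr)
    assume no: "\<not> ?thesis"
    obtain q where q: "r q" "snd q \<subseteq> T" using ex[OF T] by blast
    have "insert q F \<in> \<A>" using F q no unfolding \<A>_def by (simp, blast)
    then have "q \<in> F" using mx[of "insert q F"] by blast
    then show False using no q r[of q] by blast
  qed
  moreover have "(\<forall>q\<in>F. r q) \<and> (\<forall>q\<in>F. \<forall>q'\<in>F. q \<noteq> q' \<longrightarrow> snd q \<inter> snd q' = {})"
    using F unfolding \<A>_def by (rule CollectD)
  ultimately show ?thesis by (intro exI[of _ F]) simp
qed

text \<open>
  Baire's theorem in \<open>A\<close>. Together with \<open>dense_in_image\<close> it makes countable intersections of dense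
  open sets dense in \<open>B\<close> as well.
\<close>
lemma dense_INT_preimage:
  assumes A: "completely_metrizable_space A"
    and W: "\<And>n::nat. openin B (W n)" "\<And>n. B closure_of (W n) = topspace B"
  shows "dense_in A {x \<in> topspace A. \<forall>n. f x \<in> W n}"
proof -
  define \<G> where "\<G> = range (\<lambda>n. {x \<in> topspace A. f x \<in> W n})"
  have "A closure_of \<Inter>\<G> = topspace A"
  proof (rule Baire_category)
    show "countable \<G>" unfolding \<G>_def by blast
    fix T assume "T \<in> \<G>"
    then show "openin A T \<and> A closure_of T = topspace A"
      using open_preimage[OF W(1)] dense_preimage_open[OF W] unfolding \<G>_def by auto
  qed (use A in auto)
  moreover have "\<Inter>\<G> = {x \<in> topspace A. \<forall>n. f x \<in> W n}" unfolding \<G>_def by auto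
  ultimately have "A closure_of {x \<in> topspace A. \<forall>n. f x \<in> W n} = topspace A" by (rule subst[rotated])
  then show ?thesis unfolding dense_in_def by (intro conjI) blast
qed

text \<open>
  Refinements are iterated to a tree: its level \<open>n + 1\<close> consists of disjoint refinements of the pairs of
  level \<open>n\<close> inside the \<open>n\<close>-th dense open set \<open>U n\<close>, with first components of diameter tending to 0.
  The union \<open>S n\<close> of the second components of level \<open>n\<close> is open and dense in \<open>B\<close>. A point \<open>y\<close> in all
  \<open>S n\<close> selects a unique branch, and the first components along this branch shrink to a point \<open>x\<close> by
  completeness. Then \<open>x\<close> lies in every \<open>U n\<close>, and \<open>f x = y\<close> because every neighbourhood of \<open>y\<close> contains
  values of \<open>f\<close> on each first component.
\<close>
lemma residual_image:
  assumes A: "completely_metrizable_space A" and B: "Hausdorff_space B"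
    and D: "residual_in A D"
  shows "residual_in B (f ` D)"
proof -
  obtain M \<delta> where M: "Metric_space M \<delta>" "Metric_space.mcomplete M \<delta>"
      and AM: "A = Metric_space.mtopology M \<delta>"
    using A unfolding completely_metrizable_space_def by (elim exE conjE)
  interpret Metric_space M \<delta> by (rule M(1))
  have tA: "topspace A = M" unfolding AM by simp
  obtain G where G: "G \<subseteq> D" "gdelta_in A G" "dense_in A G"
    using D unfolding residual_in_def by blast
  obtain U where U: "\<And>n::nat. openin A (U n)" and UG: "\<Inter>(range U) = G"
    using G(2) unfolding gdelta_in_descending by blast
  have Ud: "A closure_of (U n) = topspace A" for n
  proof -
    have "G \<subseteq> U n" using UG by blast
    then have "dense_in A (U n)" using G(3) openin_subset[OF U(1)] by (meson dense_in_superset)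
    then show ?thesis unfolding dense_in_def by simp
  qed
  have reg: "regular_space A"
    using A completely_metrizable_imp_metrizable_space metrizable_imp_regular_space by blast
  define R where "R = (\<lambda>n N. \<exists>a. N \<subseteq> mcball a (inverse (Suc n)))"
  define good where "good = (\<lambda>n p F. (\<forall>q\<in>F. refines (U n) p q \<and> R n (fst q)) \<and>
            (\<forall>q\<in>F. \<forall>q'\<in>F. q \<noteq> q' \<longrightarrow> snd q \<inter> snd q' = {}) \<and>
            (\<forall>T. openin B T \<longrightarrow> T \<noteq> {} \<longrightarrow> T \<subseteq> snd p \<longrightarrow> (\<exists>q\<in>F. snd q \<inter> T \<noteq> {})))"
  have "\<exists>F. good n p F" if p: "linked p" for n p
    unfolding good_def
  proof (rule disjoint_refinement)
    fix T assume T: "openin B T" "T \<noteq> {}" "T \<subseteq> snd p"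
    have small: "\<exists>N. openin A N \<and> x \<in> N \<and> R n N" if "x \<in> topspace A" for x
    proof (intro exI conjI)
      show "openin A (mball x (inverse (Suc n)))" unfolding AM by simp
      show "x \<in> mball x (inverse (Suc n))" using that tA by simp
      show "R n (mball x (inverse (Suc n)))"
        unfolding R_def using mball_subset_mcball by blast
    qed
    have "\<exists>q. refines (U n) p q \<and> R n (fst q) \<and> snd q \<subseteq> T"
      by (rule refinement_exists[OF reg p U Ud small _ T]) (auto simp: R_def)
    then show "\<exists>q. (refines (U n) p q \<and> R n (fst q)) \<and> snd q \<subseteq> T" by blast
  qed (auto simp: refines_def)
  then have ex: "\<exists>X. good n p X" if "linked p" for n p using that by blast
  define F where "F = (\<lambda>n p. SOME X. good n p X)"
  have F: "good n p (F n p)" if "linked p" for n p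
    unfolding F_def by (rule someI_ex[OF ex[OF that]])
  have F_ref: "refines (U n) p q \<and> R n (fst q)" if "linked p" "q \<in> F n p" for n p q
    using F[OF that(1), of n] that(2) unfolding good_def by simp
  have F_disj: "snd q \<inter> snd q' = {}" if "linked p" "q \<in> F n p" "q' \<in> F n p" "q \<noteq> q'" for n p q q'
    using F[OF that(1), of n] that(2-) unfolding good_def by simp
  have F_dense: "\<exists>q\<in>F n p. snd q \<inter> T \<noteq> {}"
    if "linked p" "openin B T" "T \<noteq> {}" "T \<subseteq> snd p" for n p T
    using F[OF that(1), of n] that(2-) unfolding good_def by simp
  define L where "L = rec_nat {(topspace A, topspace B)} (\<lambda>n P. \<Union>p\<in>P. F n p)"
  have L0: "L 0 = {(topspace A, topspace B)}" and LS: "L (Suc n) = (\<Union>p\<in>L n. F n p)" for n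
    unfolding L_def by auto
  have L_linked: "linked p" if "p \<in> L n" for n p
    using that
  proof (induction n arbitrary: p)
    case 0 then show ?case by (auto simp: L0 linked_def)
  next
    case (Suc n)
    then obtain p' where "p' \<in> L n" "p \<in> F n p'" unfolding LS by blast
    then have "refines (U n) p' p" using F_ref Suc.IH by blast
    then show ?case unfolding linked_def refines_def by auto
  qed
  have L_disj: "snd p \<inter> snd q = {}" if "p \<in> L n" "q \<in> L n" "p \<noteq> q" for n p q
    using that
  proof (induction n arbitrary: p q)
    case 0 then show ?case by (auto simp: L0)
  next
    case (Suc n)
    then obtain p' q' where *: "p' \<in> L n" "p \<in> F n p'" "q' \<in> L n" "q \<in> F n q'"
      unfolding LS by blast
    then have "refines (U n) p' p" "refines (U n) q' q" using F_ref L_linked by blast+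
    then have "snd p \<subseteq> snd p'" "snd q \<subseteq> snd q'" unfolding refines_def by auto
    then show ?case
      using Suc.IH[OF *(1,3)] F_disj[OF L_linked[OF *(1)] *(2), of q] * Suc.prems(3) by blast
  qed
  define S where "S = (\<lambda>n. \<Union>p\<in>L n. snd p)"
  have S_open: "openin B (S n)" for n
    using L_linked unfolding S_def linked_def by blast
  have S_dense: "B closure_of (S n) = topspace B" for n
  proof (induction n)
    case 0 then show ?case by (simp add: S_def L0)
  next
    case (Suc n)
    show ?case unfolding dense_intersects_open
    proof (intro allI impI)
      fix T assume T: "openin B T \<and> T \<noteq> {}"
      then have "S n \<inter> T \<noteq> {}" using Suc unfolding dense_intersects_open by blast
      then obtain p where p: "p \<in> L n" "snd p \<inter> T \<noteq> {}" unfolding S_def by blast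
      have "openin B (snd p \<inter> T)" using L_linked[OF p(1)] T unfolding linked_def by blast
      then obtain q where "q \<in> F n p" "snd q \<inter> (snd p \<inter> T) \<noteq> {}"
        using F_dense[OF L_linked[OF p(1)], of "snd p \<inter> T" n] p(2) by blast
      then show "S (Suc n) \<inter> T \<noteq> {}" using p(1) unfolding S_def LS by blast
    qed
  qed
  have "y \<in> f ` D" if y: "\<And>n. y \<in> S n" for y
  proof -
    have "\<exists>p. p \<in> L n \<and> y \<in> snd p" for n using y[of n] unfolding S_def by blast
    then obtain p where p: "\<And>n. p n \<in> L n" "\<And>n. y \<in> snd (p n)" by metis
    have ref: "refines (U n) (p n) (p (Suc n)) \<and> R n (fst (p (Suc n)))" for n
    proof -
      obtain p' where p': "p' \<in> L n" "p (Suc n) \<in> F n p'" using p(1)[of "Suc n"] unfolding LS by blast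
      then have r: "refines (U n) p' (p (Suc n)) \<and> R n (fst (p (Suc n)))" using F_ref L_linked by blast
      then have "y \<in> snd p'" using p(2) unfolding refines_def by blast
      then have "p' = p n" using L_disj[OF p'(1) p(1)] p(2) by blast
      then show ?thesis using r by simp
    qed
    define C where "C = (\<lambda>n. A closure_of (fst (p (Suc n))))"
    have fst_open: "openin A (fst (p n))" for n using L_linked[OF p(1)] unfolding linked_def by blast
    have sub_cl: "fst (p (Suc n)) \<subseteq> C n" for n
      unfolding C_def by (simp add: closure_of_subset openin_subset fst_open)
    have CU: "C n \<subseteq> fst (p n)" "C n \<subseteq> U n" for n using ref unfolding C_def refines_def by blast+
    \<comment> \<open>The second component is open and contains \<open>y\<close>, so points of the dense image approach \<open>y\<close> inside
      it, and these come from the first component.\<close>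
    have meets: "\<exists>x. x \<in> fst (p n) \<and> f x \<in> T" if "openin B T" "y \<in> T" for T n
    proof -
      have l: "linked (p n)" using L_linked p(1) by blast
      then have "openin B (T \<inter> snd (p n))" "T \<inter> snd (p n) \<noteq> {}"
        using that p(2) unfolding linked_def by blast+
      then obtain x where x: "x \<in> topspace A" "f x \<in> T \<inter> snd (p n)" using open_meets_image by metis
      then have "f x \<in> f ` fst (p n)" using l unfolding linked_def by blast
      then show ?thesis using x(2) by (metis imageE IntD1)
    qed
    have yB: "y \<in> topspace B" using y[of 0] S_open openin_subset by blast
    have "decseq C" unfolding decseq_Suc_iff using CU(1) sub_cl by blast
    moreover have "closedin mtopology (C n)" for n unfolding C_def AM by simp
    moreover have "C n \<noteq> {}" for n
      using meets[of "topspace B" "Suc n"] yB sub_cl by blast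
    moreover have "\<exists>n a. C n \<subseteq> mcball a e" if e: "e > 0" for e
    proof -
      obtain n where n: "inverse (real (Suc n)) < e" using reals_Archimedean[OF e] by blast
      obtain a where "fst (p (Suc n)) \<subseteq> mcball a (inverse (Suc n))" using ref unfolding R_def by blast
      then have "C n \<subseteq> mcball a (inverse (Suc n))"
        unfolding C_def AM by (intro closure_of_minimal) auto
      also have "\<dots> \<subseteq> mcball a e" using n by (intro mcball_subset_concentric) auto
      finally show ?thesis by blast
    qed
    ultimately have "\<Inter> (range C) \<noteq> {}"
      by (intro M(2)[unfolded mcomplete_nest, THEN spec, THEN mp]) simp
    then obtain x where x: "\<And>n. x \<in> C n" by blast
    have xG: "x \<in> G" using x CU(2) UG by blast
    have xA: "x \<in> topspace A" using xG G(2) gdelta_in_subset by blast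
    have "f x = y"
    proof (rule ccontr)
      assume "f x \<noteq> y"
      moreover have "f x \<in> topspace B" using xA image_sub by blast
      ultimately obtain T T' where T: "openin B T" "openin B T'" "f x \<in> T" "y \<in> T'" "disjnt T T'"
        using B yB unfolding Hausdorff_space_def by metis
      have "openin A {z \<in> topspace A. f z \<in> T}" by (rule open_preimage[OF T(1)])
      then obtain e where e: "e > 0" "mball x e \<subseteq> {z \<in> topspace A. f z \<in> T}"
        unfolding AM openin_mtopology using xA T(3) tA by (metis (no_types, lifting) AM mem_Collect_eq)
      obtain n where n: "inverse (real (Suc n)) < e / 2"
        using reals_Archimedean[of "e/2"] e(1) by auto
      obtain a where a: "fst (p (Suc n)) \<subseteq> mcball a (inverse (Suc n))" using ref unfolding R_def by blast
      have xp: "x \<in> fst (p (Suc n))" using x CU(1) by blast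
      obtain z where z: "z \<in> fst (p (Suc n))" "f z \<in> T'" using meets[OF T(2,4)] by blast
      have "x \<in> mcball a (inverse (Suc n))" "z \<in> mcball a (inverse (Suc n))" using a xp z(1) by blast+
      then have "\<delta> x z < e" and "x \<in> M" "z \<in> M"
        using n triangle'[of x a z] by (auto simp: commute)
      then have "f z \<in> T" using e(2) by auto
      then show False using z(2) T(5) unfolding disjnt_def by blast
    qed
    then show ?thesis using xG G(1) by blast
  qed
  then have "(\<Inter>n. S n) \<subseteq> f ` D" by blast
  moreover have "gdelta_in B (\<Inter>n. S n)"
    by (rule gdelta_in_Inter) (auto intro: open_imp_gdelta_in S_open)
  moreover have "dense_in B (\<Inter>n. S n)"
  proof -
    have "dense_in B (f ` {x \<in> topspace A. \<forall>n. f x \<in> S n})"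
      by (intro dense_in_image dense_INT_preimage A S_open S_dense)
    moreover have "f ` {x \<in> topspace A. \<forall>n. f x \<in> S n} \<subseteq> (\<Inter>n. S n)" by blast
    moreover have "(\<Inter>n. S n) \<subseteq> topspace B" using openin_subset[OF S_open[of 0]] by blast
    ultimately show ?thesis by (rule dense_in_superset)
  qed
  moreover have "f ` D \<subseteq> topspace B" using D image_sub unfolding residual_in_def by blast
  ultimately show ?thesis unfolding residual_in_def by blast
qed

text \<open>
  A dense \<open>G\<^sub>\<delta>\<close> set pulls back to a dense \<open>G\<^sub>\<delta>\<close> set by \<open>dense_INT_preimage\<close>; pushing forward
  is \<open>residual_image\<close>.
\<close>
lemma residual_preimage:
  assumes A: "completely_metrizable_space A" and B: "Hausdorff_space B" and C: "C \<subseteq> topspace B"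
  shows "residual_in A {x \<in> topspace A. f x \<in> C} \<longleftrightarrow> residual_in B C"
proof
  assume "residual_in A {x \<in> topspace A. f x \<in> C}"
  then have "residual_in B (f ` {x \<in> topspace A. f x \<in> C})" by (rule residual_image[OF A B])
  moreover have "f ` {x \<in> topspace A. f x \<in> C} \<subseteq> C" by blast
  ultimately show "residual_in B C"
    using C unfolding residual_in_def by blast
next
  assume "residual_in B C"
  then obtain G where G: "G \<subseteq> C" "gdelta_in B G" "dense_in B G"
    unfolding residual_in_def by blast
  obtain W where W: "\<And>n::nat. openin B (W n)" and WG: "\<Inter>(range W) = G"
    using G(2) unfolding gdelta_in_descending by blast
  have Wd: "B closure_of (W n) = topspace B" for n
  proof -
    have "G \<subseteq> W n" using WG by blast
    then have "dense_in B (W n)" using G(3) openin_subset[OF W(1)] by (meson dense_in_superset)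
    then show ?thesis unfolding dense_in_def by simp
  qed
  have "dense_in A {x \<in> topspace A. \<forall>n. f x \<in> W n}" by (rule dense_INT_preimage[OF A W Wd])
  moreover have "gdelta_in A {x \<in> topspace A. \<forall>n. f x \<in> W n}"
  proof -
    have "gdelta_in A (\<Inter>n. {x \<in> topspace A. f x \<in> W n})"
      by (rule gdelta_in_Inter) (auto intro!: open_imp_gdelta_in open_preimage W)
    moreover have "(\<Inter>n. {x \<in> topspace A. f x \<in> W n}) = {x \<in> topspace A. \<forall>n. f x \<in> W n}" by blast
    ultimately show ?thesis by simp
  qed
  moreover have "{x \<in> topspace A. \<forall>n. f x \<in> W n} \<subseteq> {x \<in> topspace A. f x \<in> C}"
    using WG G(1) by blast
  ultimately show "residual_in A {x \<in> topspace A. f x \<in> C}"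
    unfolding residual_in_def by blast
qed

end

section \<open>Clopen partitions of the Cantor set\<close>

lemma compact_UNIV_cantor: "compact (UNIV :: (nat \<Rightarrow> bool) set)"
proof -
  have "(UNIV :: (nat \<Rightarrow> bool) set) = PiE UNIV (\<lambda>_. UNIV)" by auto
  then have "compactin (product_topology (\<lambda>_. euclidean) UNIV) (UNIV :: (nat \<Rightarrow> bool) set)"
    by (metis compactin_PiE compactin_euclidean_iff finite finite_imp_compact)
  then show ?thesis unfolding euclidean_product_topology by simp
qed

lemma compact_UNIV_cantor_square: "compact (UNIV :: ((nat \<Rightarrow> bool) \<times> (nat \<Rightarrow> bool)) set)"
  using compact_Times[OF compact_UNIV_cantor compact_UNIV_cantor] by simp

lemma continuous_on_coordinate: "continuous_on S (\<lambda>x :: 'a \<Rightarrow> 'b :: topological_space. x i)"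
  by (rule continuous_on_subset[OF continuous_on_product_coordinates]) simp

lemma open_coordinate: "open {x :: nat \<Rightarrow> bool. x i = b}"
proof -
  have "open ((\<lambda>x :: nat \<Rightarrow> bool. x i) -` {b})"
    by (rule open_vimage[OF open_discrete continuous_on_coordinate])
  then show ?thesis by (simp add: vimage_def)
qed

lemma open_coordinate_neq: "open {z :: (nat \<Rightarrow> bool) \<times> (nat \<Rightarrow> bool). fst z i \<noteq> snd z i}"
proof -
  have "{z :: (nat \<Rightarrow> bool) \<times> (nat \<Rightarrow> bool). fst z i \<noteq> snd z i} =
      {x. x i = True} \<times> {x. x i = False} \<union> {x. x i = False} \<times> {x. x i = True}" by auto
  then show ?thesis by (simp only:) (intro open_Un open_Times open_coordinate)
qed

lemma closed_coordinate_neq: "closed {z :: (nat \<Rightarrow> bool) \<times> (nat \<Rightarrow> bool). fst z i \<noteq> snd z i}"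
proof -
  have "- {z :: (nat \<Rightarrow> bool) \<times> (nat \<Rightarrow> bool). fst z i \<noteq> snd z i} =
      {x. x i = True} \<times> {x. x i = True} \<union> {x. x i = False} \<times> {x. x i = False}" by auto
  then show ?thesis
    unfolding closed_def by (simp only:) (intro open_Un open_Times open_coordinate)
qed

text \<open>
  This is uniformity of the Cantor set expressed without a metric: the sets where coordinate \<open>i\<close>
  separates the two points cover the compact complement of the neighbourhood.
\<close>
lemma neighbourhood_of_diagonal:
  fixes N :: "((nat \<Rightarrow> bool) \<times> (nat \<Rightarrow> bool)) set"
  assumes "open N" and diag: "\<And>x. (x, x) \<in> N"
  shows "\<exists>n. \<forall>a b. (\<forall>i<n. a i = b i) \<longrightarrow> (a, b) \<in> N"
proof -
  have "compact (- N)"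
    using closed_Int_compact[OF _ compact_UNIV_cantor_square, of "- N"] \<open>open N\<close> by (simp add: closed_def)
  moreover have "- N \<subseteq> (\<Union>i. {z. fst z i \<noteq> snd z i})"
  proof
    fix z assume "z \<in> - N"
    then have "fst z \<noteq> snd z" using diag[of "fst z"] by (metis ComplD prod.collapse)
    then show "z \<in> (\<Union>i. {z. fst z i \<noteq> snd z i})" by (auto simp: fun_eq_iff)
  qed
  ultimately obtain I where I: "finite I" "- N \<subseteq> (\<Union>i\<in>I. {z. fst z i \<noteq> snd z i})"
    by (rule compactE_image[OF _ open_coordinate_neq])
  obtain n where n: "\<And>i. i \<in> I \<Longrightarrow> i < n" using I(1) unfolding finite_nat_set_iff_bounded by blast
  have "(a, b) \<in> N" if "\<forall>i<n. a i = b i" for a b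
  proof (rule ccontr)
    assume "(a, b) \<notin> N"
    then have "(a, b) \<in> (\<Union>i\<in>I. {z. fst z i \<noteq> snd z i})" by (intro subsetD[OF I(2)]) simp
    then obtain i where "i \<in> I" "a i \<noteq> b i" by auto
    then show False using n that by blast
  qed
  then show ?thesis by blast
qed

lemma clopen_finitely_determined:
  fixes U :: "(nat \<Rightarrow> bool) set"
  assumes "open U" "closed U"
  shows "\<exists>n. \<forall>a b. (\<forall>i<n. a i = b i) \<longrightarrow> a \<in> U \<longrightarrow> b \<in> U"
proof -
  have "open (U \<times> U \<union> (- U) \<times> (- U))"
    using assms by (intro open_Un open_Times) (auto simp: closed_def)
  from neighbourhood_of_diagonal[OF this] obtain n
    where "\<forall>a b. (\<forall>i<n. a i = b i) \<longrightarrow> (a, b) \<in> U \<times> U \<union> (- U) \<times> (- U)" by auto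
  then show ?thesis by (intro exI[of _ n]) auto
qed

lemma continuous_on_glue:
  assumes "\<And>w. open {x. c x = w}" and "\<And>w. continuous_on UNIV (F w)"
  shows "continuous_on UNIV (\<lambda>x. F (c x) x)"
proof -
  have "continuous_on (\<Union>w\<in>UNIV. {x. c x = w}) (\<lambda>x. F (c x) x)"
  proof (rule continuous_on_open_UN)
    fix w
    have "continuous_on {x. c x = w} (F w)" by (rule continuous_on_subset[OF assms(2)]) simp
    then show "continuous_on {x. c x = w} (\<lambda>x. F (c x) x)"
      by (rule continuous_on_eq) simp
  qed (use assms(1) in auto)
  moreover have "(\<Union>w\<in>UNIV. {x. c x = w}) = UNIV" by auto
  ultimately show ?thesis by simp
qed

text \<open>
  Induction on the number of coordinates that determine \<open>U\<close>. Splitting by coordinate 0 leaves two halves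
  that are determined by one coordinate less. If both are nonempty, they are parametrized
  separately, and coordinate 0 of the parameter selects the half. If one of them is empty, \<open>U\<close> is a copy of
  the other.
\<close>
lemma finitely_determined_is_cantor:
  fixes U :: "(nat \<Rightarrow> bool) set"
  assumes "U \<noteq> {}" and "\<And>a b. (\<forall>i<n. a i = b i) \<Longrightarrow> a \<in> U \<Longrightarrow> b \<in> U"
  shows "\<exists>\<theta> :: (nat \<Rightarrow> bool) \<Rightarrow> (nat \<Rightarrow> bool). continuous_on UNIV \<theta> \<and> inj \<theta> \<and> range \<theta> = U"
  using assms
proof (induction n arbitrary: U)
  case 0
  then have "U = UNIV" by auto
  then show ?case by (intro exI[of _ id]) auto
next
  case (Suc n)
  define half where "half = (\<lambda>b. {x. case_nat b x \<in> U})"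
  have half_dep: "y \<in> half b" if xy: "\<forall>i<n. x i = y i" and x: "x \<in> half b" for x y b
  proof -
    have "\<forall>i<Suc n. case_nat b x i = case_nat b y i"
      using xy by (auto split: nat.split)
    then show ?thesis using Suc.prems(2) x unfolding half_def by blast
  qed
  have IH: "\<exists>\<theta> :: (nat \<Rightarrow> bool) \<Rightarrow> (nat \<Rightarrow> bool). continuous_on UNIV \<theta> \<and> inj \<theta> \<and> range \<theta> = half b"
    if "half b \<noteq> {}" for b
    by (rule Suc.IH[OF that]) (rule half_dep)
  have eta: "case_nat (x 0) (\<lambda>i. x (Suc i)) = x" for x :: "nat \<Rightarrow> bool"
    by (rule ext) (simp split: nat.split)
  have U: "U = (\<Union>b. case_nat b ` half b)"
  proof (intro equalityI subsetI)
    fix x assume "x \<in> U"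
    then have "(\<lambda>i. x (Suc i)) \<in> half (x 0)" unfolding half_def using eta[of x] by simp
    then have "x \<in> case_nat (x 0) ` half (x 0)" by (rule image_eqI[OF eta[symmetric]])
    then show "x \<in> (\<Union>b. case_nat b ` half b)" by blast
  qed (auto simp: half_def)
  have cn: "continuous_on S (case_nat b :: (nat \<Rightarrow> bool) \<Rightarrow> _)" for b S
  proof (rule continuous_on_coordinatewise_then_product)
    fix i show "continuous_on S (\<lambda>x. case_nat b x i)"
      by (cases i) (auto intro: continuous_on_coordinate)
  qed
  have cn_inj: "case_nat b x = case_nat b' x' \<longleftrightarrow> b = b' \<and> x = x'" for b b' and x x' :: "nat \<Rightarrow> bool"
    by (auto simp: fun_eq_iff split: nat.splits)
  show ?case
  proof (cases "\<exists>b. half b = {}")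
    case True
    then obtain b where b: "half b = {}" by blast
    have U': "U = case_nat (\<not> b) ` half (\<not> b)"
    proof -
      have univ: "(UNIV :: bool set) = {b, \<not> b}" by auto
      show ?thesis by (subst U, subst univ) (simp add: b)
    qed
    then have "half (\<not> b) \<noteq> {}" using Suc.prems(1) by blast
    then obtain \<theta> :: "(nat \<Rightarrow> bool) \<Rightarrow> nat \<Rightarrow> bool"
      where \<theta>: "continuous_on UNIV \<theta>" "inj \<theta>" "range \<theta> = half (\<not> b)" using IH[of "\<not> b"] by blast
    show ?thesis
    proof (intro exI[of _ "case_nat (\<not> b) \<circ> \<theta>"] conjI)
      show "continuous_on UNIV (case_nat (\<not> b) \<circ> \<theta>)"
        by (rule continuous_on_compose[OF \<theta>(1) cn])
      show "inj (case_nat (\<not> b) \<circ> \<theta>)" using \<theta>(2) by (auto simp: inj_def cn_inj)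
      show "range (case_nat (\<not> b) \<circ> \<theta>) = U" unfolding U' \<theta>(3)[symmetric] by auto
    qed
  next
    case False
    then obtain \<theta> :: "bool \<Rightarrow> (nat \<Rightarrow> bool) \<Rightarrow> nat \<Rightarrow> bool"
      where \<theta>: "\<And>b. continuous_on UNIV (\<theta> b)" "\<And>b. inj (\<theta> b)" "\<And>b. range (\<theta> b) = half b"
      using IH by metis
    define F where "F = (\<lambda>b x. case_nat b (\<theta> b (\<lambda>i. x (Suc i))))"
    have tail: "continuous_on UNIV (\<lambda>x :: nat \<Rightarrow> bool. \<lambda>i. x (Suc i))"
      by (rule continuous_on_coordinatewise_then_product) (rule continuous_on_coordinate)
    show ?thesis
    proof (intro exI[of _ "\<lambda>x. F (x 0) x"] conjI)
      show "continuous_on UNIV (\<lambda>x. F (x 0) x)"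
      proof (rule continuous_on_glue[where c = "\<lambda>x. x 0" and F = F, OF open_coordinate])
        fix b
        have "continuous_on UNIV (\<lambda>x. \<theta> b (\<lambda>i. x (Suc i)))"
          by (rule continuous_on_compose2[OF \<theta>(1) tail subset_UNIV])
        from continuous_on_compose2[OF cn this subset_UNIV, of b] show "continuous_on UNIV (F b)"
          unfolding F_def .
      qed
      show "inj (\<lambda>x. F (x 0) x)"
      proof (rule injI)
        fix x y assume "F (x 0) x = F (y 0) y"
        then have x0: "x 0 = y 0" and xS: "\<theta> (x 0) (\<lambda>i. x (Suc i)) = \<theta> (x 0) (\<lambda>i. y (Suc i))"
          unfolding F_def by (auto simp: cn_inj)
        have "(\<lambda>i. x (Suc i)) = (\<lambda>i. y (Suc i))"
          using \<theta>(2)[of "x 0"] xS by (simp only: inj_eq)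
        then have "case_nat (x 0) (\<lambda>i. x (Suc i)) = case_nat (y 0) (\<lambda>i. y (Suc i))"
          using x0 by (rule arg_cong2[rotated])
        from trans[OF trans[OF eta[of x, symmetric] this] eta[of y]] show "x = y" .
      qed
      show "range (\<lambda>x. F (x 0) x) = U"
      proof (intro equalityI subsetI)
        fix y assume "y \<in> range (\<lambda>x. F (x 0) x)"
        then show "y \<in> U" unfolding U F_def using \<theta>(3) by blast
      next
        fix y assume "y \<in> U"
        then obtain b z where "y = case_nat b z" "z \<in> half b" unfolding U by blast
        then have "z \<in> range (\<theta> b)" by (simp only: \<theta>(3))
        then obtain t where "z = \<theta> b t" by (elim rangeE)
        then have "y = case_nat b (\<theta> b t)" using \<open>y = case_nat b z\<close> by (simp only:)
        then have "y = (\<lambda>x. F (x 0) x) (case_nat b t)" unfolding F_def by simp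
        then show "y \<in> range (\<lambda>x. F (x 0) x)" by blast
      qed
    qed
  qed
qed

lemma nonempty_clopen_is_cantor:
  fixes U :: "(nat \<Rightarrow> bool) set"
  assumes "open U" "closed U" "U \<noteq> {}"
  shows "\<exists>\<theta> :: (nat \<Rightarrow> bool) \<Rightarrow> (nat \<Rightarrow> bool). continuous_on UNIV \<theta> \<and> inj \<theta> \<and> range \<theta> = U"
proof -
  obtain n where "\<forall>a b. (\<forall>i<n. a i = b i) \<longrightarrow> a \<in> U \<longrightarrow> b \<in> U"
    using clopen_finitely_determined[OF assms(1,2)] by blast
  then show ?thesis by (intro finitely_determined_is_cantor[OF assms(3), of n]) blast
qed

definition prefix :: "nat \<Rightarrow> (nat \<Rightarrow> bool) \<Rightarrow> bool list" where
  "prefix n x = map x [0..<n]"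

lemma prefix_eq_iff: "prefix n x = prefix n y \<longleftrightarrow> (\<forall>i<n. x i = y i)"
  unfolding prefix_def by auto

lemma prefix_surj: "length w = n \<Longrightarrow> \<exists>x. prefix n x = w \<and> (\<lambda>i. x (i + n)) = t"
  unfolding prefix_def
  by (rule exI[of _ "\<lambda>i. if i < n then w ! i else t (i - n)"]) (auto intro: nth_equalityI)

lemma length_prefix [simp]: "length (prefix n x) = n"
  unfolding prefix_def by simp

lemma open_prefix: "open {x. prefix n x = w}"
proof (cases "length w = n")
  case True
  have "{x. prefix n x = w} = (\<Inter>i\<in>{..<n}. {x. x i = w ! i})"
    using True unfolding prefix_def by (auto simp: list_eq_iff_nth_eq)
  then show ?thesis by (simp only:) (intro open_INT ballI open_coordinate finite_lessThan)
next
  case False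
  then have "{x. prefix n x = w} = {}" by auto
  then show ?thesis by simp
qed

text \<open>
  The pieces \<open>V w\<close> pull back to nonempty clopen sets along any homeomorphism from the Cantor set, so
  each is a Cantor set and can be parametrized by the cylinder of all sequences with prefix \<open>w\<close>.
\<close>
lemma cantor_adapted_parametrization:
  fixes Y :: "'a :: t2_space set" and V :: "bool list \<Rightarrow> 'a set"
  assumes Y: "is_cantor (top_of_set Y)"
    and V_open: "\<And>w. openin (top_of_set Y) (V w)"
    and V_ne: "\<And>w. length w = n \<Longrightarrow> V w \<noteq> {}"
    and V_disj: "\<And>w w'. length w = n \<Longrightarrow> length w' = n \<Longrightarrow> w \<noteq> w' \<Longrightarrow> V w \<inter> V w' = {}"
    and V_cover: "Y \<subseteq> (\<Union>w\<in>{w. length w = n}. V w)"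
  shows "\<exists>h. continuous_on UNIV h \<and> inj h \<and> range h = Y \<and> (\<forall>x. h x \<in> V (prefix n x))"
proof -
  obtain k where k: "homeomorphic_map cantor_space (top_of_set Y) k"
    using Y homeomorphic_space_sym unfolding is_cantor_def homeomorphic_space by blast
  have k_cont: "continuous_on UNIV k" and k_inj: "inj k" and k_range: "range k = Y"
    using homeomorphic_imp_continuous_map[OF k] homeomorphic_imp_injective_map[OF k]
      homeomorphic_imp_surjective_map[OF k] by (auto simp: continuous_map_in_subtopology)
  define U where "U = (\<lambda>w. k -` V w)"
  have U_open: "open (U w)" for w
  proof -
    obtain T where T: "open T" "V w = Y \<inter> T" using V_open[of w] unfolding openin_open by blast
    then have "U w = k -` T" using k_range unfolding U_def by blast
    then show ?thesis using open_vimage[OF T(1) k_cont] by simp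
  qed
  have VY: "V w \<subseteq> Y" for w using openin_subset[OF V_open[of w]] by simp
  have U_closed: "closed (U w)" if w: "length w = n" for w
  proof -
    have "- U w = (\<Union>w'\<in>{w'. length w' = n \<and> w' \<noteq> w}. U w')"
    proof (intro equalityI subsetI)
      fix x assume x: "x \<in> - U w"
      have "k x \<in> Y" using k_range by blast
      then obtain w' where "length w' = n" "k x \<in> V w'" using V_cover by blast
      then show "x \<in> (\<Union>w'\<in>{w'. length w' = n \<and> w' \<noteq> w}. U w')" using x unfolding U_def by blast
    next
      fix x assume "x \<in> (\<Union>w'\<in>{w'. length w' = n \<and> w' \<noteq> w}. U w')"
      then show "x \<in> - U w" using V_disj[OF w] unfolding U_def by blast
    qed
    then show ?thesis unfolding closed_def using U_open by auto
  qed
  have U_ne: "U w \<noteq> {}" if "length w = n" for w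
    using V_ne[OF that] VY[of w] k_range unfolding U_def by blast
  have "\<exists>\<theta> :: (nat \<Rightarrow> bool) \<Rightarrow> (nat \<Rightarrow> bool). continuous_on UNIV \<theta> \<and>
      (length w = n \<longrightarrow> inj \<theta> \<and> range \<theta> = U w)" for w
  proof (cases "length w = n")
    case True
    then show ?thesis using nonempty_clopen_is_cantor[OF U_open U_closed U_ne] by simp
  next
    case False
    then show ?thesis by (intro exI[of _ id]) simp
  qed
  then obtain \<theta> :: "bool list \<Rightarrow> (nat \<Rightarrow> bool) \<Rightarrow> (nat \<Rightarrow> bool)" where
    \<theta>: "\<And>w. continuous_on UNIV (\<theta> w)" "\<And>w. length w = n \<Longrightarrow> inj (\<theta> w)"
      "\<And>w. length w = n \<Longrightarrow> range (\<theta> w) = U w"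
    by metis
  define F where "F = (\<lambda>w (x :: nat \<Rightarrow> bool). k (\<theta> w (\<lambda>i. x (i + n))))"
  define h where "h = (\<lambda>x. F (prefix n x) x)"
  have "continuous_on UNIV h" unfolding h_def
  proof (rule continuous_on_glue[where c = "prefix n" and F = F, OF open_prefix])
    fix w
    have "continuous_on UNIV (\<lambda>x :: nat \<Rightarrow> bool. \<lambda>i. x (i + n))"
      by (rule continuous_on_coordinatewise_then_product) (rule continuous_on_coordinate)
    then have "continuous_on UNIV (\<lambda>x. \<theta> w (\<lambda>i. x (i + n)))"
      by (rule continuous_on_compose2[OF \<theta>(1) _ subset_UNIV])
    from continuous_on_compose2[OF k_cont this subset_UNIV] show "continuous_on UNIV (F w)"
      unfolding F_def .
  qed
  moreover have hV: "h x \<in> V (prefix n x)" for x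
  proof -
    have "\<theta> (prefix n x) (\<lambda>i. x (i + n)) \<in> U (prefix n x)" using \<theta>(3)[of "prefix n x"] by auto
    then show ?thesis unfolding h_def F_def U_def by simp
  qed
  moreover have "inj h"
  proof (rule injI)
    fix x y assume xy: "h x = h y"
    have p: "prefix n x = prefix n y"
    proof (rule ccontr)
      assume "prefix n x \<noteq> prefix n y"
      then have "V (prefix n x) \<inter> V (prefix n y) = {}" by (intro V_disj) auto
      then show False using hV[of x] hV[of y] xy by auto
    qed
    have "\<theta> (prefix n x) (\<lambda>i. x (i + n)) = \<theta> (prefix n x) (\<lambda>i. y (i + n))"
      using xy p k_inj unfolding h_def F_def by (simp add: inj_eq)
    then have t: "(\<lambda>i. x (i + n)) = (\<lambda>i. y (i + n))" using \<theta>(2)[of "prefix n x"] by (simp add: inj_eq)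
    show "x = y"
    proof
      fix i show "x i = y i"
      proof (cases "i < n")
        case True then show ?thesis using p unfolding prefix_eq_iff by blast
      next
        case False then show ?thesis using fun_cong[OF t, of "i - n"] by simp
      qed
    qed
  qed
  moreover have "range h = Y"
  proof (intro equalityI subsetI)
    fix y assume "y \<in> range h" then show "y \<in> Y" using hV VY by blast
  next
    fix y assume y: "y \<in> Y"
    then obtain w where w: "length w = n" "y \<in> V w" using V_cover by blast
    obtain z where z: "y = k z" using y k_range by blast
    then have "z \<in> range (\<theta> w)" using w \<theta>(3)[OF w(1)] unfolding U_def by simp
    then obtain t where t: "z = \<theta> w t" by blast
    obtain x where "prefix n x = w" "(\<lambda>i. x (i + n)) = t" using prefix_surj[OF w(1)] by metis
    then have "y = h x" unfolding h_def F_def using z t by simp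
    then show "y \<in> range h" by blast
  qed
  ultimately show ?thesis by blast
qed

section \<open>Moduli of continuity by compactness\<close>

text \<open>
  Uniform continuity of a map, and of the inverse of an embedding, with respect to an arbitrary compatible
  metric on the Cantor set will be obtained from this: on the compact set where \<open>e \<le> v\<close>, the function
  \<open>u\<close> has a positive minimum.
\<close>
lemma compact_modulus:
  fixes u v :: "'a :: topological_space \<Rightarrow> real"
  assumes S: "compact S" and u: "continuous_on S u" and v: "continuous_on S v"
    and uv: "\<And>z. z \<in> S \<Longrightarrow> u z \<le> 0 \<Longrightarrow> v z < e"
  shows "\<exists>r>0. \<forall>z\<in>S. u z < r \<longrightarrow> v z < e"
proof -
  define S' where "S' = {z \<in> S. e \<le> v z}"
  have S': "compact S'"
  proof -
    obtain T where T: "closed T" "T \<inter> S = v -` {e..} \<inter> S"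
      using v unfolding continuous_on_closed_invariant by (meson closed_atLeast)
    have "S' = S \<inter> T" using T(2) unfolding S'_def by auto
    then show ?thesis using compact_Int_closed[OF S T(1)] by simp
  qed
  show ?thesis
  proof (cases "S' = {}")
    case True
    then show ?thesis unfolding S'_def by (intro exI[of _ 1]) auto
  next
    case False
    have "continuous_on S' u" by (rule continuous_on_subset[OF u]) (auto simp: S'_def)
    then obtain z0 where z0: "z0 \<in> S'" "\<And>z. z \<in> S' \<Longrightarrow> u z0 \<le> u z"
      using continuous_attains_inf[OF S' False] by blast
    have "u z0 > 0" using uv[of z0] z0(1) unfolding S'_def by force
    then show ?thesis using z0(2) unfolding S'_def by (intro exI[of _ "u z0"]) force
  qed
qed

lemma prefix_modulus:
  fixes h :: "(nat \<Rightarrow> bool) \<Rightarrow> 'a :: metric_space"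
  assumes h: "continuous_on UNIV h" and e: "e > 0"
  shows "\<exists>n. \<forall>a b. prefix n a = prefix n b \<longrightarrow> dist (h a) (h b) < e"
proof -
  have c: "continuous_on UNIV (\<lambda>z. dist (h (fst z)) (h (snd z)))"
    by (intro continuous_on_dist continuous_on_compose2[OF h] continuous_on_fst continuous_on_snd
        continuous_on_id) auto
  have "open {z. dist (h (fst z)) (h (snd z)) < e}"
    by (intro open_Collect_less c continuous_on_const)
  from neighbourhood_of_diagonal[OF this] e show ?thesis unfolding prefix_eq_iff by simp
qed

lemma separation_on_closed:
  fixes h :: "(nat \<Rightarrow> bool) \<Rightarrow> 'a :: metric_space"
  assumes h: "continuous_on UNIV h" and S: "closed S" and ne: "\<And>a b. (a, b) \<in> S \<Longrightarrow> h a \<noteq> h b"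
  shows "\<exists>r>0. \<forall>(a, b)\<in>S. r \<le> dist (h a) (h b)"
proof -
  have S': "compact S" using compact_Int_closed[OF compact_UNIV_cantor_square S] by simp
  have c: "continuous_on S (\<lambda>z. dist (h (fst z)) (h (snd z)))"
    by (intro continuous_on_dist continuous_on_compose2[OF h] continuous_on_fst continuous_on_snd
        continuous_on_id) auto
  have "\<exists>r>0. \<forall>z\<in>S. dist (h (fst z)) (h (snd z)) < r \<longrightarrow> (1::real) < 1"
    by (rule compact_modulus[OF S' c continuous_on_const]) (use ne in auto)
  then obtain r where r: "r > 0" "\<forall>z\<in>S. \<not> dist (h (fst z)) (h (snd z)) < r" by auto
  then show ?thesis by (intro exI[of _ r]) fastforce
qed

lemma prefix_separation:
  fixes h :: "(nat \<Rightarrow> bool) \<Rightarrow> 'a :: metric_space"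
  assumes h: "continuous_on UNIV h" and inj: "inj h"
  shows "\<exists>r>0. \<forall>a b. prefix n a \<noteq> prefix n b \<longrightarrow> r \<le> dist (h a) (h b)"
proof -
  define S where "S = (\<Union>i\<in>{..<n}. {z :: (nat \<Rightarrow> bool) \<times> (nat \<Rightarrow> bool). fst z i \<noteq> snd z i})"
  have S: "closed S" unfolding S_def by (intro closed_UN ballI closed_coordinate_neq finite_lessThan)
  have "\<exists>r>0. \<forall>(a, b)\<in>S. r \<le> dist (h a) (h b)"
    by (rule separation_on_closed[OF h S]) (use inj in \<open>auto simp: S_def inj_eq\<close>)
  moreover have "(a, b) \<in> S" if "prefix n a \<noteq> prefix n b" for a b
    using that unfolding S_def prefix_eq_iff by auto
  ultimately show ?thesis by fast
qed

section \<open>The space of embeddings onto subshifts\<close>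

definition unshift :: "point \<Rightarrow> point" where
  "unshift x = (\<lambda>i. x (i - 1))"

lemma shift_unshift [simp]: "shift (unshift x) = x"
  unfolding shift_def unshift_def by simp

lemma unshift_shift [simp]: "unshift (shift x) = x"
  unfolding shift_def unshift_def by simp

lemma continuous_on_shift: "continuous_on S shift"
proof (rule continuous_on_coordinatewise_then_product)
  fix i show "continuous_on S (\<lambda>x. shift x i)"
    unfolding shift_def by (rule continuous_on_coordinate)
qed

lemma continuous_on_unshift: "continuous_on S unshift"
proof (rule continuous_on_coordinatewise_then_product)
  fix i show "continuous_on S (\<lambda>x. unshift x i)"
    unfolding unshift_def by (rule continuous_on_coordinate)
qed

definition cube :: "point set" where
  "cube = {x. \<forall>i. x i \<in> hilbert_cube}"

lemma compact_PiE_UNIV: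
  fixes S :: "'i \<Rightarrow> 'a :: topological_space set"
  assumes "\<And>i. compact (S i)"
  shows "compact {x. \<forall>i. x i \<in> S i}"
proof -
  have "compactin (product_topology (\<lambda>_. euclidean) UNIV) (PiE UNIV S)"
    using assms by (simp add: compactin_PiE)
  moreover have "PiE UNIV S = {x. \<forall>i. x i \<in> S i}" by (auto simp: PiE_UNIV_domain)
  ultimately show ?thesis unfolding euclidean_product_topology by simp
qed

lemma compact_cube: "compact cube"
proof -
  have eq: "hilbert_cube = {x. \<forall>n. x n \<in> {0..1}}" unfolding hilbert_cube_def by auto
  have "compact hilbert_cube" unfolding eq by (intro compact_PiE_UNIV compact_Icc)
  then show ?thesis unfolding cube_def by (intro compact_PiE_UNIV)
qed

lemma bounded_point: "bounded (S :: point set)"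
  unfolding bounded_def using dist_point_le by blast

lemma bcontfun_of_continuous:
  fixes h :: "'a :: topological_space \<Rightarrow> point"
  assumes "continuous_on UNIV h"
  obtains h' :: "'a \<Rightarrow>\<^sub>C point" where "apply_bcontfun h' = h"
proof -
  have "h \<in> bcontfun" using assms bounded_point unfolding bcontfun_def by blast
  then show ?thesis using that Bcontfun_inverse by blast
qed

text \<open>
  A Cauchy sequence in the uniform metric converges uniformly to its pointwise limit, and uniform limits of
  continuous functions on any topological space are continuous.
\<close>
lemma complete_bcontfun:
  "complete (UNIV :: ('a :: topological_space \<Rightarrow>\<^sub>C 'b :: complete_space) set)"
  unfolding complete_def
proof (intro allI impI)
  fix f :: "nat \<Rightarrow> 'a \<Rightarrow>\<^sub>C 'b"
  assume "(\<forall>n. f n \<in> UNIV) \<and> Cauchy f"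
  then have "Cauchy f" by simp
  then have "uniformly_Cauchy_on UNIV (\<lambda>n. apply_bcontfun (f n))"
    unfolding Cauchy_def by (intro uniformly_Cauchy_onI) (metis dist_fun_lt_imp_dist_val_lt)
  then have "uniformly_convergent_on UNIV (\<lambda>n. apply_bcontfun (f n))"
    by (rule Cauchy_uniformly_convergent)
  then obtain g where "uniform_limit UNIV f g sequentially"
    unfolding uniformly_convergent_on_def by blast
  from uniform_limit_bcontfunE[OF this sequentially_bot]
  show "\<exists>l\<in>UNIV. f \<longlonglongrightarrow> l" by (metis UNIV_I)
qed

lemma completely_metrizable_bcontfun:
  "completely_metrizable_space (euclidean :: ('a :: topological_space \<Rightarrow>\<^sub>C 'b :: complete_space) topology)"
  using Met_TC.completely_metrizable_space_mtopology complete_bcontfun by auto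

text \<open>
  Invariance of the range is stated as two inclusions because each of them is a closed condition under
  uniform convergence.
\<close>
definition subshift_embeddings :: "((nat \<Rightarrow> bool) \<Rightarrow>\<^sub>C point) set" where
  "subshift_embeddings =
     {h. inj (apply_bcontfun h) \<and> (\<forall>x. apply_bcontfun h x \<in> cube) \<and>
      (\<forall>x. shift (apply_bcontfun h x) \<in> range (apply_bcontfun h)) \<and>
      (\<forall>x. unshift (apply_bcontfun h x) \<in> range (apply_bcontfun h))}"

lemma tendsto_apply_bcontfun:
  assumes "(f \<longlonglongrightarrow> l)"
  shows "(\<lambda>n. apply_bcontfun (f n) x) \<longlonglongrightarrow> apply_bcontfun l x"
  using tendsto_bcontfun_uniform_limit[OF assms] by (rule tendsto_uniform_limitI) simp

text \<open>
  If \<open>f n\<close> tends to \<open>l\<close> uniformly, then \<open>g (l x)\<close> is approximated by \<open>g (f n x) = f n y\<close>, hence by \<open>l y\<close>, for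
  suitable \<open>y\<close> that depend on \<open>n\<close>; the range of \<open>l\<close> is compact.
\<close>
lemma closed_range_invariant:
  fixes g :: "'b :: metric_space \<Rightarrow> 'b"
  assumes K: "compact (UNIV :: 'a :: topological_space set)" and g: "continuous_on UNIV g"
  shows "closed {h :: 'a \<Rightarrow>\<^sub>C 'b. \<forall>x. g (apply_bcontfun h x) \<in> range (apply_bcontfun h)}"
  unfolding closed_sequential_limits
proof (intro allI impI)
  fix f :: "nat \<Rightarrow> 'a \<Rightarrow>\<^sub>C 'b" and l
  assume "(\<forall>n. f n \<in> {h. \<forall>x. g (apply_bcontfun h x) \<in> range (apply_bcontfun h)}) \<and> f \<longlonglongrightarrow> l"
  then have f: "\<And>n x. g (f n x) \<in> range (apply_bcontfun (f n))" and lim: "f \<longlonglongrightarrow> l" by auto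
  have cl: "closed (range (apply_bcontfun l))"
    by (intro compact_imp_closed compact_continuous_image[OF _ K]) simp
  have "g (l x) \<in> range (apply_bcontfun l)" for x
  proof -
    have "\<exists>y\<in>range (apply_bcontfun l). dist y (g (l x)) < e" if e: "e > 0" for e
    proof -
      have "(\<lambda>n. g (f n x)) \<longlonglongrightarrow> g (l x)"
        using continuous_on_tendsto_compose[OF g tendsto_apply_bcontfun[OF lim]] by simp
      then have "\<forall>\<^sub>F n in sequentially. dist (g (f n x)) (g (l x)) < e / 2"
        using e by (intro tendstoD) auto
      moreover have "\<forall>\<^sub>F n in sequentially. dist (f n) l < e / 2"
        using lim e by (intro tendstoD) auto
      ultimately have "\<forall>\<^sub>F n in sequentially. dist (g (f n x)) (g (l x)) < e / 2 \<and> dist (f n) l < e / 2"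
        by (rule eventually_conj)
      then obtain n where n: "dist (g (f n x)) (g (l x)) < e / 2" "dist (f n) l < e / 2"
        using eventually_happens'[OF sequentially_bot] by blast
      obtain y where y: "g (f n x) = f n y" using f[of n x] by blast
      have "dist (l y) (g (l x)) \<le> dist (f n y) (l y) + dist (f n y) (g (l x))"
        by (rule dist_triangle3)
      also have "\<dots> < e / 2 + e / 2"
        using dist_fun_lt_imp_dist_val_lt[OF n(2), of y] n(1) unfolding y by (rule add_strict_mono)
      finally show ?thesis by auto
    qed
    then show ?thesis using closed_approachable[OF cl, of "g (l x)"] by blast
  qed
  then show "l \<in> {h. \<forall>x. g (apply_bcontfun h x) \<in> range (apply_bcontfun h)}" by blast
qed

lemma closed_pointwise:
  assumes "closed S"
  shows "closed {h :: 'a :: topological_space \<Rightarrow>\<^sub>C 'b :: metric_space. \<forall>x. apply_bcontfun h x \<in> S}"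
  unfolding closed_sequential_limits
proof (intro allI impI)
  fix f :: "nat \<Rightarrow> 'a \<Rightarrow>\<^sub>C 'b" and l
  assume "(\<forall>n. f n \<in> {h. \<forall>x. apply_bcontfun h x \<in> S}) \<and> f \<longlonglongrightarrow> l"
  then have f: "\<And>n x. f n x \<in> S" and lim: "f \<longlonglongrightarrow> l" by auto
  have "l x \<in> S" for x
    using closed_sequentially[OF assms _ tendsto_apply_bcontfun[OF lim]] f by blast
  then show "l \<in> {h. \<forall>x. apply_bcontfun h x \<in> S}" by blast
qed

text \<open>
  Pairs that differ at coordinate \<open>n\<close> form a compact set, so a map that separates them does so by a positive
  distance, which survives small perturbations. Injectivity is the conjunction of these
  conditions over all \<open>n\<close>, hence a \<open>G\<^sub>\<delta>\<close> condition.
\<close>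
lemma open_separating_coordinate:
  "open {h :: (nat \<Rightarrow> bool) \<Rightarrow>\<^sub>C 'b :: metric_space.
     \<forall>a b. a n \<noteq> b n \<longrightarrow> apply_bcontfun h a \<noteq> apply_bcontfun h b}"
  unfolding open_dist
proof
  fix h :: "(nat \<Rightarrow> bool) \<Rightarrow>\<^sub>C 'b"
  assume "h \<in> {h. \<forall>a b. a n \<noteq> b n \<longrightarrow> apply_bcontfun h a \<noteq> apply_bcontfun h b}"
  then have h: "h a \<noteq> h b" if "a n \<noteq> b n" for a b using that by simp
  define S where "S = {z :: (nat \<Rightarrow> bool) \<times> (nat \<Rightarrow> bool). fst z n \<noteq> snd z n}"
  have "h a \<noteq> h b" if "(a, b) \<in> S" for a b using h[of a b] that unfolding S_def by simp
  then obtain r where r0: "r > 0" "\<forall>(a, b)\<in>S. r \<le> dist (h a) (h b)"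
    using separation_on_closed[OF continuous_on_apply_bcontfun closed_coordinate_neq[of n, folded S_def]]
    by metis
  have r: "r \<le> dist (h a) (h b)" if "a n \<noteq> b n" for a b
    using bspec[OF r0(2), of "(a, b)"] that unfolding S_def by simp
  have "k a \<noteq> k b" if k: "dist k h < r / 2" and ab: "a n \<noteq> b n" for k a b
  proof
    assume "k a = k b"
    then have "dist (h a) (h b) \<le> dist (k a) (h a) + dist (k b) (h b)"
      using dist_triangle3[of "h a" "h b" "k a"] by simp
    also have "\<dots> < r / 2 + r / 2"
      using dist_fun_lt_imp_dist_val_lt[OF k] by (intro add_strict_mono) auto
    finally show False using r[of a b] ab by simp
  qed
  then show "\<exists>e>0. \<forall>k. dist k h < e \<longrightarrow> k \<in> {h. \<forall>a b. a n \<noteq> b n \<longrightarrow> apply_bcontfun h a \<noteq> apply_bcontfun h b}"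
    using r0(1) by (intro exI[of _ "r / 2"]) simp
qed

lemma gdelta_subshift_embeddings: "gdelta_in euclidean subshift_embeddings"
proof -
  define I where "I = (\<lambda>n. {h :: (nat \<Rightarrow> bool) \<Rightarrow>\<^sub>C point.
    \<forall>a b. a n \<noteq> b n \<longrightarrow> apply_bcontfun h a \<noteq> apply_bcontfun h b})"
  have "gdelta_in euclidean (I n)" for n
    unfolding I_def
    by (intro open_imp_gdelta_in) (simp only: open_openin[symmetric] open_separating_coordinate)
  then have "gdelta_in euclidean (\<Inter>n. I n)" by (intro gdelta_in_Inter) auto
  moreover have "gdelta_in euclidean {h :: (nat \<Rightarrow> bool) \<Rightarrow>\<^sub>C point. \<forall>x. apply_bcontfun h x \<in> cube}"
    by (intro closed_imp_gdelta_in metrizable_space_euclidean)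
      (simp add: closed_pointwise compact_imp_closed compact_cube)
  moreover have "gdelta_in euclidean {h :: (nat \<Rightarrow> bool) \<Rightarrow>\<^sub>C point.
      \<forall>x. shift (apply_bcontfun h x) \<in> range (apply_bcontfun h)}"
    by (intro closed_imp_gdelta_in metrizable_space_euclidean)
      (simp add: closed_range_invariant compact_UNIV_cantor continuous_on_shift)
  moreover have "gdelta_in euclidean {h :: (nat \<Rightarrow> bool) \<Rightarrow>\<^sub>C point.
      \<forall>x. unshift (apply_bcontfun h x) \<in> range (apply_bcontfun h)}"
    by (intro closed_imp_gdelta_in metrizable_space_euclidean)
      (simp add: closed_range_invariant compact_UNIV_cantor continuous_on_unshift)
  ultimately have G: "gdelta_in euclidean ((\<Inter>n. I n) \<inter> ({h. \<forall>x. apply_bcontfun h x \<in> cube} \<inter>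
      ({h. \<forall>x. shift (apply_bcontfun h x) \<in> range (apply_bcontfun h)} \<inter>
       {h. \<forall>x. unshift (apply_bcontfun h x) \<in> range (apply_bcontfun h)})))"
    by (intro gdelta_in_Int)
  have inj_iff: "inj (apply_bcontfun h) \<longleftrightarrow> (\<forall>n a b. a n \<noteq> b n \<longrightarrow> h a \<noteq> h b)"
    for h :: "(nat \<Rightarrow> bool) \<Rightarrow>\<^sub>C point"
  proof
    assume inj: "inj (apply_bcontfun h)"
    show "\<forall>n a b. a n \<noteq> b n \<longrightarrow> h a \<noteq> h b"
    proof (intro allI impI notI)
      fix n and a b :: "nat \<Rightarrow> bool"
      assume "a n \<noteq> b n" "h a = h b"
      then show False using injD[OF inj] by metis
    qed
  next
    assume sep: "\<forall>n a b. a n \<noteq> b n \<longrightarrow> h a \<noteq> h b"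
    show "inj (apply_bcontfun h)"
    proof (intro injI ext)
      fix a b i assume "h a = h b"
      then show "a i = b i" using sep by metis
    qed
  qed
  have "subshift_embeddings = (\<Inter>n. I n) \<inter> ({h. \<forall>x. apply_bcontfun h x \<in> cube} \<inter>
      ({h. \<forall>x. shift (apply_bcontfun h x) \<in> range (apply_bcontfun h)} \<inter>
       {h. \<forall>x. unshift (apply_bcontfun h x) \<in> range (apply_bcontfun h)}))"
    by (rule set_eqI) (simp only: subshift_embeddings_def I_def inj_iff Int_iff INT_iff mem_Collect_eq
        UNIV_I simp_thms ball_UNIV)
  then show ?thesis using G by (simp only:)
qed

lemma subshift_embeddingsD:
  assumes "h \<in> subshift_embeddings"
  shows "inj (apply_bcontfun h)" "h x \<in> cube"
    "shift (h x) \<in> range (apply_bcontfun h)" "unshift (h x) \<in> range (apply_bcontfun h)"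
  using assms unfolding subshift_embeddings_def by auto

lemma range_subshift_embedding:
  assumes h: "h \<in> subshift_embeddings"
  shows "range (apply_bcontfun h) \<in> subshifts"
proof -
  have "closed (range (apply_bcontfun h))"
    by (intro compact_imp_closed compact_continuous_image compact_UNIV_cantor) simp
  moreover have "shift ` range (apply_bcontfun h) = range (apply_bcontfun h)"
  proof (intro equalityI subsetI)
    fix y assume "y \<in> range (apply_bcontfun h)"
    then have "unshift y \<in> range (apply_bcontfun h)" using subshift_embeddingsD(4)[OF h] by blast
    then show "y \<in> shift ` range (apply_bcontfun h)" by (metis imageI shift_unshift)
  qed (use subshift_embeddingsD(3)[OF h] in blast)
  moreover have "\<forall>x\<in>range (apply_bcontfun h). \<forall>i. x i \<in> hilbert_cube"
    using subshift_embeddingsD(2)[OF h] unfolding cube_def by blast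
  ultimately show ?thesis unfolding subshifts_def by blast
qed

lemma subshift_embeddingI:
  assumes "inj (apply_bcontfun h)" "range (apply_bcontfun h) \<in> subshifts"
  shows "h \<in> subshift_embeddings"
proof -
  have r: "\<forall>x\<in>range (apply_bcontfun h). \<forall>i. x i \<in> hilbert_cube"
      "shift ` range (apply_bcontfun h) = range (apply_bcontfun h)"
    using assms(2) unfolding subshifts_def by auto
  have "h x \<in> cube" for x using r(1) unfolding cube_def by blast
  moreover have sh: "shift (h x) \<in> range (apply_bcontfun h)" for x using r(2) by blast
  moreover have "unshift (h x) \<in> range (apply_bcontfun h)" for x
  proof -
    obtain z where "z \<in> range (apply_bcontfun h)" "h x = shift z" using r(2) by blast
    then show ?thesis by simp
  qed
  ultimately show ?thesis using assms(1) unfolding subshift_embeddings_def by blast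
qed

definition induced :: "((nat \<Rightarrow> bool) \<Rightarrow>\<^sub>C point) \<Rightarrow> (nat \<Rightarrow> bool) \<Rightarrow> (nat \<Rightarrow> bool)" where
  "induced h = (\<lambda>x. inv (apply_bcontfun h) (shift (h x)))"

lemma apply_induced: "h \<in> subshift_embeddings \<Longrightarrow> h (induced h x) = shift (h x)"
  unfolding induced_def by (rule f_inv_into_f[of _ "apply_bcontfun h" UNIV, OF subshift_embeddingsD(3)])

lemma induced_eqI:
  assumes "h \<in> subshift_embeddings" and "\<And>x. h (\<phi> x) = shift (h x)"
  shows "induced h = \<phi>"
proof
  fix x show "induced h x = \<phi> x"
    using apply_induced[OF assms(1)] assms(2) subshift_embeddingsD(1)[OF assms(1)] by (metis injD)
qed

lemma
  assumes h: "h \<in> subshift_embeddings"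
  shows induced_homeo: "induced h \<in> homeos"
    and apply_inv_induced: "h (inv (induced h) x) = unshift (h x)"
proof -
  define T' where "T' = (\<lambda>x. inv (apply_bcontfun h) (unshift (h x)))"
  have hT': "h (T' x) = unshift (h x)" for x
    unfolding T'_def by (rule f_inv_into_f[of _ "apply_bcontfun h" UNIV, OF subshift_embeddingsD(4)[OF h]])
  have hT: "h (induced h x) = shift (h x)" for x by (rule apply_induced[OF h])
  note inj = subshift_embeddingsD(1)[OF h]
  have id: "induced h (T' x) = x" "T' (induced h x) = x" for x
    by (rule injD[OF inj], simp add: hT hT')+
  have ci: "continuous_on (range (apply_bcontfun h)) (inv (apply_bcontfun h))"
    by (rule continuous_on_inv) (use inj compact_UNIV_cantor in auto)
  have "continuous_on UNIV (\<lambda>x. inv (apply_bcontfun h) (shift (h x)))"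
  proof (rule continuous_on_compose2[OF ci])
    show "continuous_on UNIV (\<lambda>x. shift (h x))"
      by (rule continuous_on_compose2[OF continuous_on_shift _ subset_UNIV]) simp
  qed (use subshift_embeddingsD(3)[OF h] in blast)
  then have c: "continuous_on UNIV (induced h)" unfolding induced_def .
  have c': "continuous_on UNIV T'" unfolding T'_def
  proof (rule continuous_on_compose2[OF ci])
    show "continuous_on UNIV (\<lambda>x. unshift (h x))"
      by (rule continuous_on_compose2[OF continuous_on_unshift _ subset_UNIV]) simp
  qed (use subshift_embeddingsD(4)[OF h] in blast)
  have "homeomorphic_maps cantor_space cantor_space (induced h) T'"
    using c c' id unfolding homeomorphic_maps_def by simp
  then show "induced h \<in> homeos" unfolding homeos_def homeomorphic_map_maps by blast
  have "inv (induced h) = T'" by (rule inv_equality) (use id in auto)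
  then show "h (inv (induced h) x) = unshift (h x)" using hT' by simp
qed

section \<open>The induced homeomorphism depends openly on the embedding\<close>

lemma continuous_compatible_metric:
  assumes "compatible_metric d"
  shows "continuous_on UNIV (\<lambda>z. d (fst z) (snd z))"
proof -
  interpret Metric_space UNIV d using assms unfolding compatible_metric_def by simp
  have m: "mtopology_of (metric (UNIV, d)) = euclidean"
    using assms unfolding compatible_metric_def mtopology_of_def by simp
  have "continuous_map euclidean euclideanreal (\<lambda>(x, y). d x y)"
    using continuous_map_metric[of "metric (UNIV, d)"] unfolding m by simp
  then show ?thesis by (simp add: case_prod_unfold)
qed

lemma compatible_metricD:
  assumes "compatible_metric d"
  shows "0 \<le> d x y" "d x x = 0" "d x y \<le> 0 \<Longrightarrow> x = y"
proof -
  interpret Metric_space UNIV d using assms unfolding compatible_metric_def by simp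
  show "0 \<le> d x y" by simp
  show "d x x = 0" by simp
  show "x = y" if "d x y \<le> 0" using that nonneg[of x y] by simp
qed

lemma compatible_metric_modulus:
  assumes d: "compatible_metric d" and v: "continuous_on UNIV v"
    and zero: "\<And>a. v (a, a) < (e :: real)"
  shows "\<exists>r>0. \<forall>a b. d a b < r \<longrightarrow> v (a, b) < e"
proof -
  have "\<exists>r>0. \<forall>z\<in>UNIV. d (fst z) (snd z) < r \<longrightarrow> v z < e"
  proof (rule compact_modulus[OF compact_UNIV_cantor_square continuous_compatible_metric[OF d] v])
    fix z :: "(nat \<Rightarrow> bool) \<times> (nat \<Rightarrow> bool)"
    assume "d (fst z) (snd z) \<le> 0"
    from compatible_metricD(3)[OF d this] have "z = (fst z, fst z)" by (simp add: prod_eq_iff)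
    then show "v z < e" using zero[of "fst z"] by simp
  qed
  then show ?thesis by (metis UNIV_I fst_conv snd_conv)
qed

lemma compatible_metric_embedding_modulus:
  fixes h :: "(nat \<Rightarrow> bool) \<Rightarrow> 'a :: metric_space"
  assumes d: "compatible_metric d" and h: "continuous_on UNIV h" "inj h" and e: "e > 0"
  shows "\<exists>r>0. \<forall>a b. dist (h a) (h b) < r \<longrightarrow> d a b < e"
proof -
  have c: "continuous_on UNIV (\<lambda>z. dist (h (fst z)) (h (snd z)))"
    by (intro continuous_on_dist continuous_on_compose2[OF h(1)] continuous_on_fst continuous_on_snd
        continuous_on_id) auto
  have "\<exists>r>0. \<forall>z\<in>UNIV. dist (h (fst z)) (h (snd z)) < r \<longrightarrow> d (fst z) (snd z) < e"
  proof (rule compact_modulus[OF compact_UNIV_cantor_square c continuous_compatible_metric[OF d]])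
    fix z :: "(nat \<Rightarrow> bool) \<times> (nat \<Rightarrow> bool)"
    assume "dist (h (fst z)) (h (snd z)) \<le> 0"
    then have "fst z = snd z" using injD[OF h(2)] by simp
    then show "d (fst z) (snd z) < e"
      using compatible_metricD(2)[OF d] e by simp
  qed
  then show ?thesis by (metis UNIV_I fst_conv snd_conv)
qed

lemma cube_modulus:
  fixes g :: "point \<Rightarrow> point"
  assumes g: "continuous_on UNIV g" and e: "e > 0"
  shows "\<exists>r>0. \<forall>x\<in>cube. \<forall>y\<in>cube. dist x y < r \<longrightarrow> dist (g x) (g y) < e"
proof -
  have "uniformly_continuous_on cube g"
    by (rule compact_uniformly_continuous[OF continuous_on_subset[OF g] compact_cube]) simp
  then show ?thesis
    using e unfolding uniformly_continuous_on_def by (metis dist_commute)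
qed

lemma homeo_dist_upper:
  assumes d: "compatible_metric d"
  shows "d (\<phi> x) (\<psi> x) + d (inv \<phi> x) (inv \<psi> x) \<le> homeo_dist d \<phi> \<psi>"
proof -
  have "compact (range (\<lambda>z. d (fst z) (snd z)))"
    by (rule compact_continuous_image[OF continuous_compatible_metric[OF d] compact_UNIV_cantor_square])
  then have "bdd_above (range (\<lambda>z. d (fst z) (snd z)))"
    by (intro bounded_imp_bdd_above compact_imp_bounded)
  then obtain B where B: "\<forall>w\<in>range (\<lambda>z. d (fst z) (snd z)). w \<le> B"
    unfolding bdd_above_def by blast
  have dB: "d a b \<le> B" for a b
    using bspec[OF B rangeI[of _ "(a, b)"]] by simp
  have "bdd_above (range (\<lambda>x. d (\<phi> x) (\<psi> x) + d (inv \<phi> x) (inv \<psi> x)))"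
    by (rule bdd_aboveI[of _ "B + B"]) (use add_mono[OF dB dB] in fast)
  then show ?thesis unfolding homeo_dist_def by (intro cSUP_upper) auto
qed

lemma homeo_dist_apply:
  assumes d: "compatible_metric d"
  shows "d (\<phi> x) (\<psi> x) \<le> homeo_dist d \<phi> \<psi>" "d (inv \<phi> x) (inv \<psi> x) \<le> homeo_dist d \<phi> \<psi>"
proof -
  show "d (\<phi> x) (\<psi> x) \<le> homeo_dist d \<phi> \<psi>" "d (inv \<phi> x) (inv \<psi> x) \<le> homeo_dist d \<phi> \<psi>"
    using homeo_dist_upper[OF d, of \<phi> x \<psi>] compatible_metricD(1)[OF d, of "\<phi> x" "\<psi> x"]
      compatible_metricD(1)[OF d, of "inv \<phi> x" "inv \<psi> x"] by linarith+
qed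

text \<open>
  If \<open>h\<close> is close to \<open>h0\<close>, then \<open>h0 (induced h x)\<close> is close to \<open>h (induced h x) = shift (h x)\<close>, hence to
  \<open>shift (h0 x) = h0 (induced h0 x)\<close>, and \<open>h0\<close> has a uniformly continuous inverse. The inverse
  homeomorphisms are compared in the same way, with \<open>unshift\<close>.
\<close>
lemma induced_continuous:
  assumes d: "compatible_metric d" and h0: "h0 \<in> subshift_embeddings" and e: "e > 0"
  shows "\<exists>r>0. \<forall>h\<in>subshift_embeddings. dist h0 h < r \<longrightarrow> homeo_dist d (induced h0) (induced h) < e"
proof -
  have "e / 3 > 0" using e by simp
  from compatible_metric_embedding_modulus[OF d continuous_on_apply_bcontfun 
      subshift_embeddingsD(1)[OF h0] this]
  obtain r where r: "r > 0" "\<And>a b. dist (h0 a) (h0 b) < r \<Longrightarrow> d a b < e / 3" by blast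
  obtain s where s: "s > 0" "\<And>x y. x \<in> cube \<Longrightarrow> y \<in> cube \<Longrightarrow> dist x y < s \<Longrightarrow> dist (shift x) (shift y) < r / 2"
    using cube_modulus[OF continuous_on_shift, of "r / 2"] r(1) by auto
  obtain t where t: "t > 0" "\<And>x y. x \<in> cube \<Longrightarrow> y \<in> cube \<Longrightarrow> dist x y < t \<Longrightarrow> dist (unshift x) (unshift y) < r / 2"
    using cube_modulus[OF continuous_on_unshift, of "r / 2"] r(1) by auto
  have "homeo_dist d (induced h0) (induced h) < e"
    if h: "h \<in> subshift_embeddings" and close: "dist h0 h < min (r / 2) (min s t)" for h
  proof -
    \<comment> \<open>The distance of \<open>h0 b\<close> and \<open>h b\<close> costs the other half of \<open>r\<close>.\<close>
    have near: "d a b < e / 3" if "dist (h0 a) (h b) < r / 2" for a b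
    proof (rule r(2))
      have "dist (h0 b) (h b) < r / 2" using dist_fun_lt_imp_dist_val_lt[OF close, of b] by simp
      then show "dist (h0 a) (h0 b) < r" using that dist_triangle2[of "h0 a" "h0 b" "h b"] by linarith
    qed
    have dx: "dist (h0 x) (h x) < s" "dist (h0 x) (h x) < t" for x
      using dist_fun_lt_imp_dist_val_lt[OF close, of x] by auto
    have 1: "d (induced h0 x) (induced h x) < e / 3" for x
      by (rule near, simp only: apply_induced[OF h] apply_induced[OF h0])
        (intro s(2) subshift_embeddingsD(2) h h0 dx)
    have 2: "d (inv (induced h0) x) (inv (induced h) x) < e / 3" for x
      by (rule near, simp only: apply_inv_induced[OF h] apply_inv_induced[OF h0])
        (intro t(2) subshift_embeddingsD(2) h h0 dx)
    have "homeo_dist d (induced h0) (induced h) \<le> e / 3 + e / 3"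
      unfolding homeo_dist_def using 1 2 by (intro cSUP_least add_mono less_imp_le) auto
    then show ?thesis using e by linarith
  qed
  then show ?thesis using r(1) s(1) t(1) by (intro exI[of _ "min (r / 2) (min s t)"]) auto
qed

definition orbit :: "('a \<Rightarrow> 'a) \<Rightarrow> int \<Rightarrow> 'a \<Rightarrow> 'a" where
  "orbit \<psi> i = (if 0 \<le> i then \<psi> ^^ nat i else inv \<psi> ^^ nat (- i))"

lemma orbit_0 [simp]: "orbit \<psi> 0 x = x"
  unfolding orbit_def by simp

lemma orbit_add_1:
  assumes "bij \<psi>"
  shows "orbit \<psi> (i + 1) x = orbit \<psi> i (\<psi> x)" and "orbit \<psi> (i - 1) x = orbit \<psi> i (inv \<psi> x)"
    and "orbit \<psi> (i + 1) x = \<psi> (orbit \<psi> i x)" and "orbit \<psi> (i - 1) x = inv \<psi> (orbit \<psi> i x)"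
proof -
  have inv: "inv \<psi> (\<psi> x) = x" "\<psi> (inv \<psi> x) = x" for x
    using assms by (simp_all add: bij_is_inj bij_is_surj surj_f_inv_f)
  have pos: "nat (i + 1) = Suc (nat i)" if "0 \<le> i" using that by simp
  have neg: "nat (- i) = Suc (nat (- (i + 1)))" if "i < 0" using that by simp
  have pos': "nat i = Suc (nat (i - 1))" if "0 < i" using that by simp
  have neg': "nat (- (i - 1)) = Suc (nat (- i))" if "i \<le> 0" using that by simp
  have w: "orbit \<psi> (i + 1) x = \<psi> (orbit \<psi> i x)" for x
    unfolding orbit_def using pos neg inv by (cases "0 \<le> i"; cases "i = -1") auto
  have w2: "orbit \<psi> (i - 1) x = inv \<psi> (orbit \<psi> i x)" for x
    unfolding orbit_def using pos' neg' inv by (cases "0 < i"; cases "i = 0") auto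
  have c: "orbit \<psi> i (\<psi> x) = \<psi> (orbit \<psi> i x)" for x
  proof -
    have "(inv \<psi> ^^ n) (\<psi> x) = \<psi> ((inv \<psi> ^^ n) x)" for n
      by (induction n) (simp_all add: inv)
    then show ?thesis unfolding orbit_def by (simp add: funpow_swap1)
  qed
  have c2: "orbit \<psi> i (inv \<psi> x) = inv \<psi> (orbit \<psi> i x)" for x
  proof -
    have "(\<psi> ^^ n) (inv \<psi> x) = inv \<psi> ((\<psi> ^^ n) x)" for n
      by (induction n) (simp_all add: inv)
    then show ?thesis unfolding orbit_def by (simp add: funpow_swap1)
  qed
  show "orbit \<psi> (i + 1) x = orbit \<psi> i (\<psi> x)" "orbit \<psi> (i - 1) x = orbit \<psi> i (inv \<psi> x)"
    "orbit \<psi> (i + 1) x = \<psi> (orbit \<psi> i x)" "orbit \<psi> (i - 1) x = inv \<psi> (orbit \<psi> i x)"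
    using w w2 c c2 by auto
qed

lemma homeosD:
  assumes "\<psi> \<in> homeos"
  shows "bij \<psi>" "continuous_on UNIV \<psi>" "continuous_on UNIV (inv \<psi>)"
proof -
  have h: "homeomorphic_map cantor_space cantor_space \<psi>" using assms unfolding homeos_def by simp
  then obtain g where g: "homeomorphic_maps cantor_space cantor_space \<psi> g"
    unfolding homeomorphic_map_maps by blast
  then have "g = inv \<psi>" unfolding homeomorphic_maps_def by (intro inv_equality[symmetric]) auto
  then show "continuous_on UNIV \<psi>" "continuous_on UNIV (inv \<psi>)"
    using g unfolding homeomorphic_maps_def by auto
  show "bij \<psi>"
    using homeomorphic_imp_injective_map[OF h] homeomorphic_imp_surjective_map[OF h]
    by (simp add: bij_def)
qed

lemma orbit_continuous:
  assumes "\<psi> \<in> homeos"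
  shows "continuous_on UNIV (orbit \<psi> i)"
proof (induction i rule: int_induct[where k = 0])
  case base
  have "orbit \<psi> 0 = id" by auto
  then show ?case by simp
next
  case (step1 i)
  have "orbit \<psi> (i + 1) = \<psi> \<circ> orbit \<psi> i" using orbit_add_1(3)[OF homeosD(1)[OF assms]] by auto
  then show ?case
    using continuous_on_compose[OF step1.IH continuous_on_subset[OF homeosD(2)[OF assms] subset_UNIV]]
    by (simp only:)
next
  case (step2 i)
  have "orbit \<psi> (i - 1) = inv \<psi> \<circ> orbit \<psi> i" using orbit_add_1(4)[OF homeosD(1)[OF assms]] by auto
  then show ?case
    using continuous_on_compose[OF step2.IH continuous_on_subset[OF homeosD(3)[OF assms] subset_UNIV]]
    by (simp only:)
qed

text \<open>
  The induction step of \<open>orbit_near\<close>, stated for a family of maps \<open>f \<psi>\<close> near \<open>\<phi>\<close> so that it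
  applies both to the homeomorphisms and to their inverses.
\<close>
lemma orbit_near_step:
  assumes d: "compatible_metric d" and \<phi>: "continuous_on UNIV \<phi>"
    and close: "\<And>\<psi> x. \<psi> \<in> \<Psi> \<Longrightarrow> d (\<phi> x) (f \<psi> x) \<le> D \<psi>"
    and IH: "\<And>e. e > 0 \<Longrightarrow> \<exists>r>0. \<forall>\<psi>\<in>\<Psi>. D \<psi> < r \<longrightarrow> (\<forall>x. d (a x) (b \<psi> x) < e)"
    and e: "e > (0::real)"
  shows "\<exists>r>0. \<forall>\<psi>\<in>\<Psi>. D \<psi> < r \<longrightarrow> (\<forall>x. d (\<phi> (a x)) (f \<psi> (b \<psi> x)) < e)"
proof -
  interpret Metric_space UNIV d using d unfolding compatible_metric_def by simp
  have "continuous_on UNIV (\<lambda>z :: (nat \<Rightarrow> bool) \<times> (nat \<Rightarrow> bool). (\<phi> (fst z), \<phi> (snd z)))"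
    by (intro continuous_on_Pair continuous_on_compose2[OF \<phi>] continuous_on_fst continuous_on_snd
        continuous_on_id) auto
  from continuous_on_compose2[OF continuous_compatible_metric[OF d] this subset_UNIV]
  have c: "continuous_on UNIV (\<lambda>z. d (\<phi> (fst z)) (\<phi> (snd z)))" by simp
  obtain s where s: "s > 0" "\<And>a b. d a b < s \<Longrightarrow> d (\<phi> a) (\<phi> b) < e / 2"
    using compatible_metric_modulus[OF d c, of "e / 2"] e by auto
  obtain r where r: "r > 0" "\<And>\<psi> x. \<psi> \<in> \<Psi> \<Longrightarrow> D \<psi> < r \<Longrightarrow> d (a x) (b \<psi> x) < s"
    using IH[OF s(1)] by blast
  have "d (\<phi> (a x)) (f \<psi> (b \<psi> x)) < e" if "\<psi> \<in> \<Psi>" "D \<psi> < min r (e / 2)" for \<psi> x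
  proof -
    have "d (\<phi> (a x)) (f \<psi> (b \<psi> x)) \<le> d (\<phi> (a x)) (\<phi> (b \<psi> x)) + d (\<phi> (b \<psi> x)) (f \<psi> (b \<psi> x))"
      by (rule triangle) auto
    moreover have "d (\<phi> (a x)) (\<phi> (b \<psi> x)) < e / 2" using that by (intro s(2) r(2)) auto
    moreover have "d (\<phi> (b \<psi> x)) (f \<psi> (b \<psi> x)) < e / 2"
      using close[OF that(1), of "b \<psi> x"] that(2) by linarith
    ultimately show ?thesis by linarith
  qed
  then show ?thesis using r(1) e by (intro exI[of _ "min r (e / 2)"]) auto
qed

lemma orbit_near:
  assumes d: "compatible_metric d" and \<phi>: "\<phi> \<in> homeos" and e: "e > 0"
  shows "\<exists>r>0. \<forall>\<psi>\<in>homeos. homeo_dist d \<phi> \<psi> < r \<longrightarrow> (\<forall>x. d (orbit \<phi> i x) (orbit \<psi> i x) < e)"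
  using e
proof (induction i arbitrary: e rule: int_induct[where k = 0])
  case base
  then show ?case using compatible_metricD(2)[OF d] by (intro exI[of _ 1]) simp
next
  case (step1 i)
  have *: "orbit \<psi> (i + 1) x = \<psi> (orbit \<psi> i x)" if "\<psi> \<in> homeos" for \<psi> x
    using orbit_add_1(3)[OF homeosD(1)[OF that]] .
  have "\<exists>r>0. \<forall>\<psi>\<in>homeos. homeo_dist d \<phi> \<psi> < r \<longrightarrow> (\<forall>x. d (\<phi> (orbit \<phi> i x)) (\<psi> (orbit \<psi> i x)) < e)"
    by (rule orbit_near_step[where f = "\<lambda>\<psi>. \<psi>", OF d homeosD(2)[OF \<phi>] _ step1.IH step1.prems])
      (rule homeo_dist_apply(1)[OF d])
  then show ?case using * \<phi> by simp
next
  case (step2 i)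
  have *: "orbit \<psi> (i - 1) x = inv \<psi> (orbit \<psi> i x)" if "\<psi> \<in> homeos" for \<psi> x
    using orbit_add_1(4)[OF homeosD(1)[OF that]] .
  have "\<exists>r>0. \<forall>\<psi>\<in>homeos. homeo_dist d \<phi> \<psi> < r \<longrightarrow> (\<forall>x. d (inv \<phi> (orbit \<phi> i x)) (inv \<psi> (orbit \<psi> i x)) < e)"
    by (rule orbit_near_step[where f = inv, OF d homeosD(3)[OF \<phi>] _ step2.IH step2.prems])
      (rule homeo_dist_apply(2)[OF d])
  then show ?case using * \<phi> by simp
qed

text \<open>
  The coordinates enumerated after the first \<open>N\<close> contribute at most \<open>(1/2) ^ N\<close> to the distance.
\<close>
lemma fun_dist_modulus:
  assumes "e > 0"
  shows "\<exists>J. finite J \<and> (\<exists>r>0. \<forall>x y :: 'a :: countable \<Rightarrow> 'b :: metric_space.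
           (\<forall>i\<in>J. dist (x i) (y i) < r) \<longrightarrow> dist x y < e)"
proof -
  obtain N where N: "(1/2 :: real) ^ N < e / 2"
    using real_arch_pow_inv[of "e / 2" "1/2"] assms by auto
  define J :: "'a set" where "J = from_nat ` {..N}"
  have "dist x y < e" if xy: "\<forall>i\<in>J. dist (x i) (y i) < e / 4" for x y :: "'a \<Rightarrow> 'b"
  proof -
    define D where "D = {dist (x (from_nat n)) (y (from_nat n)) |n. n \<le> N}"
    have D: "D = (\<lambda>n. dist (x (from_nat n)) (y (from_nat n))) ` {..N}" unfolding D_def by auto
    have "Max D < e / 4"
      using xy unfolding D J_def by (subst Max_less_iff) auto
    moreover have "dist x y \<le> 2 * Max D + (1/2) ^ N"
      unfolding D_def by (rule dist_fun_le_dist_first_terms)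
    ultimately show ?thesis using N by linarith
  qed
  moreover have "finite J" unfolding J_def by simp
  ultimately show ?thesis using assms by (intro exI[of _ J] conjI exI[of _ "e / 4"]) auto
qed

lemma point_dist_modulus:
  assumes "e > 0"
  shows "\<exists>J m. finite J \<and> (\<exists>r>0. \<forall>x y :: point.
           (\<forall>i\<in>J. \<forall>n<m. \<bar>x i n - y i n\<bar> < r) \<longrightarrow> dist x y < e)"
proof -
  obtain J :: "int set" and s where J: "finite J" "s > 0"
    "\<And>x y :: point. (\<forall>i\<in>J. dist (x i) (y i) < s) \<Longrightarrow> dist x y < e"
    using fun_dist_modulus[OF assms, where 'a = int and 'b = "nat \<Rightarrow> real"] by blast
  obtain I :: "nat set" and r where I: "finite I" "r > 0"
    "\<And>x y :: nat \<Rightarrow> real. (\<forall>n\<in>I. dist (x n) (y n) < r) \<Longrightarrow> dist x y < s"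
    using fun_dist_modulus[OF J(2), where 'a = nat and 'b = real] by blast
  obtain m where m: "\<And>n. n \<in> I \<Longrightarrow> n < m" using I(1) unfolding finite_nat_set_iff_bounded by blast
  have "dist x y < e" if "\<forall>i\<in>J. \<forall>n<m. \<bar>x i n - y i n\<bar> < r" for x y :: point
    by (rule J(3), intro ballI I(3)) (use that m in \<open>simp add: dist_real_def\<close>)
  then show ?thesis using J(1) I(2) by (intro exI[of _ J] exI[of _ m] conjI exI[of _ r]) auto
qed

text \<open>
  An embedding is determined by its coordinate 0: the other coordinates are read off along the orbits.
\<close>
lemma orbit_induced:
  assumes h: "h \<in> subshift_embeddings"
  shows "h (orbit (induced h) i x) j = h x (j + i)"
proof (induction i arbitrary: j rule: int_induct[where k = 0])
  case base show ?case by simp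
next
  case (step1 i)
  have "h (orbit (induced h) (i + 1) x) = shift (h (orbit (induced h) i x))"
    using orbit_add_1(3)[OF homeosD(1)[OF induced_homeo[OF h]]] apply_induced[OF h] by simp
  then have "h (orbit (induced h) (i + 1) x) j = h (orbit (induced h) i x) (j + 1)"
    by (simp add: shift_def)
  then show ?case using step1.IH[of "j + 1"] by (simp add: algebra_simps)
next
  case (step2 i)
  have "h (orbit (induced h) (i - 1) x) = unshift (h (orbit (induced h) i x))"
    using orbit_add_1(4)[OF homeosD(1)[OF induced_homeo[OF h]]] apply_inv_induced[OF h] by simp
  then have "h (orbit (induced h) (i - 1) x) j = h (orbit (induced h) i x) (j - 1)"
    by (simp add: unshift_def)
  then show ?case using step2.IH[of "j - 1"] by (simp add: algebra_simps)
qed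

lemma finite_uniform_radius:
  assumes "finite J" and "\<And>i. i \<in> J \<Longrightarrow> \<exists>r>0. \<forall>\<psi>\<in>\<Psi>. D \<psi> < (r :: real) \<longrightarrow> R i \<psi>"
  shows "\<exists>r>0. \<forall>\<psi>\<in>\<Psi>. D \<psi> < r \<longrightarrow> (\<forall>i\<in>J. R i \<psi>)"
  using assms
proof (induction J rule: finite_induct)
  case empty
  then show ?case by (intro exI[of _ 1]) auto
next
  case (insert i J)
  obtain r where r: "r > 0" "\<forall>\<psi>\<in>\<Psi>. D \<psi> < r \<longrightarrow> (\<forall>i\<in>J. R i \<psi>)"
    using insert.IH insert.prems by auto
  obtain s where s: "s > 0" "\<forall>\<psi>\<in>\<Psi>. D \<psi> < s \<longrightarrow> R i \<psi>"
    using insert.prems by auto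
  show ?case using r s by (intro exI[of _ "min r s"]) auto
qed

lemma itinerary_embedding:
  fixes g :: "(nat \<Rightarrow> bool) \<Rightarrow> nat \<Rightarrow> real"
  assumes \<psi>: "\<psi> \<in> homeos" and g: "continuous_on UNIV g" "inj g" "\<And>x. g x \<in> hilbert_cube"
  obtains h where "h \<in> subshift_embeddings" "induced h = \<psi>" "\<And>x i. h x i = g (orbit \<psi> i x)"
proof -
  have "continuous_on UNIV (\<lambda>x i. g (orbit \<psi> i x))"
    by (intro continuous_on_coordinatewise_then_product
        continuous_on_compose2[OF g(1) orbit_continuous[OF \<psi>] subset_UNIV])
  then obtain h :: "(nat \<Rightarrow> bool) \<Rightarrow>\<^sub>C point" where h': "apply_bcontfun h = (\<lambda>x i. g (orbit \<psi> i x))"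
    using bcontfun_of_continuous by metis
  then have h: "h x i = g (orbit \<psi> i x)" for x i by simp
  note step = orbit_add_1[OF homeosD(1)[OF \<psi>]]
  have sh: "h (\<psi> x) = shift (h x)" for x
    by (rule ext) (simp add: shift_def h step)
  have ush: "h (inv \<psi> x) = unshift (h x)" for x
    by (rule ext) (simp add: unshift_def h step)
  have "inj (apply_bcontfun h)"
  proof (rule injI)
    fix x y assume "h x = h y"
    then have "g x = g y" using h[of x 0] h[of y 0] by simp
    then show "x = y" using g(2) by (simp add: inj_eq)
  qed
  moreover have "h x \<in> cube" for x unfolding cube_def using g(3) by (simp add: h)
  moreover have "shift (h x) \<in> range (apply_bcontfun h)" for x using sh[of x] by (metis rangeI)
  moreover have "unshift (h x) \<in> range (apply_bcontfun h)" for x using ush[of x] by (metis rangeI)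
  ultimately have E: "h \<in> subshift_embeddings" unfolding subshift_embeddings_def by simp
  moreover have "induced h = \<psi>" by (rule induced_eqI[OF E sh])
  ultimately show ?thesis using that h by blast
qed

text \<open>
  Closeness in the Hilbert cube depends on finitely many coordinates, so all later ones are free
  to record the point itself.
\<close>
lemma injective_perturbation:
  fixes f :: "(nat \<Rightarrow> bool) \<Rightarrow> nat \<Rightarrow> real"
  assumes f: "continuous_on UNIV f" "\<And>x. f x \<in> hilbert_cube"
  obtains g where "continuous_on UNIV g" "inj g" "\<And>x. g x \<in> hilbert_cube" "\<And>x n. n < m \<Longrightarrow> g x n = f x n"
proof -
  define g where "g = (\<lambda>x n. if n < m then f x n else of_bool (x (n - m)))"
  have "continuous_on UNIV g"
  proof (rule continuous_on_coordinatewise_then_product)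
    fix n
    have c: "continuous_on UNIV (\<lambda>x. f x n)"
      by (rule continuous_on_compose2[OF continuous_on_coordinate[of UNIV n] f(1) subset_UNIV])
    have c': "continuous_on UNIV (\<lambda>x :: nat \<Rightarrow> bool. of_bool (x (n - m)) :: real)"
      by (rule continuous_on_glue[where c = "\<lambda>x. x (n - m)" and F = "\<lambda>b x. of_bool b", OF open_coordinate])
        (rule continuous_on_const)
    show "continuous_on UNIV (\<lambda>x. g x n)"
      unfolding g_def using c c' by (cases "n < m") simp_all
  qed
  moreover have "inj g"
  proof (intro injI ext)
    fix x y i assume "g x = g y"
    then have "g x (i + m) = g y (i + m)" by simp
    then show "x i = y i" unfolding g_def by (simp split: if_splits add: of_bool_def)
  qed
  moreover have "g x \<in> hilbert_cube" for x
    using f(2)[of x] unfolding g_def hilbert_cube_def by simp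
  ultimately show ?thesis by (rule that) (simp add: g_def)
qed

text \<open>
  By \<open>orbit_induced\<close>, the embedding \<open>h0\<close> consists of the itineraries of \<open>induced h0\<close> under the function
  \<open>f\<close>. The required embedding consists of the itineraries of \<open>\<psi>\<close> under an injective \<open>g\<close> that agrees
  with \<open>f\<close> on the coordinates that matter. The finitely many iterates that matter are
  close for the two homeomorphisms.
\<close>
lemma induced_open:
  assumes d: "compatible_metric d" and h0: "h0 \<in> subshift_embeddings" and e: "e > 0"
  shows "\<exists>r>0. \<forall>\<psi>\<in>homeos. homeo_dist d (induced h0) \<psi> < r \<longrightarrow>
           (\<exists>h\<in>subshift_embeddings. dist h0 h < e \<and> induced h = \<psi>)"
proof -
  define \<phi> where "\<phi> = induced h0"
  have \<phi>: "\<phi> \<in> homeos" unfolding \<phi>_def by (rule induced_homeo[OF h0])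
  define f where "f = (\<lambda>x. h0 x 0)"
  have f_cont: "continuous_on UNIV f"
    unfolding f_def
    by (rule continuous_on_compose2[OF continuous_on_coordinate[of UNIV 0]
          continuous_on_apply_bcontfun subset_UNIV])
  have f_cube: "f x \<in> hilbert_cube" for x
    using subshift_embeddingsD(2)[OF h0, of x] unfolding f_def cube_def by blast
  have orbit_f: "h0 x i = f (orbit \<phi> i x)" for x i
    using orbit_induced[OF h0, of i x 0] unfolding \<phi>_def f_def by simp
  have "e / 2 > 0" using e by simp
  from point_dist_modulus[OF this] obtain J m \<eta> where J: "finite J" and \<eta>: "\<eta> > 0"
    and J\<eta>: "\<And>x y :: point. (\<forall>i\<in>J. \<forall>n<m. \<bar>x i n - y i n\<bar> < \<eta>) \<Longrightarrow> dist x y < e / 2" by blast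
  define v where "v = (\<lambda>z. \<Sum>n<m. \<bar>f (fst z) n - f (snd z) n\<bar>)"
  have fn: "continuous_on UNIV (\<lambda>x. f x n)" for n
    by (rule continuous_on_compose2[OF continuous_on_coordinate[of UNIV n] f_cont subset_UNIV])
  have "continuous_on UNIV v"
    unfolding v_def
    by (intro continuous_on_sum continuous_on_rabs continuous_on_diff
        continuous_on_compose2[OF fn] continuous_on_fst continuous_on_snd continuous_on_id) auto
  from compatible_metric_modulus[OF d this, of \<eta>] \<eta>
  obtain s where s: "s > 0" "\<And>a b. d a b < s \<Longrightarrow> v (a, b) < \<eta>" unfolding v_def by auto
  have "\<exists>r>0. \<forall>\<psi>\<in>homeos. homeo_dist d \<phi> \<psi> < r \<longrightarrow> (\<forall>i\<in>J. \<forall>x. d (orbit \<phi> i x) (orbit \<psi> i x) < s)"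
    by (rule finite_uniform_radius[OF J]) (rule orbit_near[OF d \<phi> s(1)])
  then obtain r where r: "r > 0"
    "\<And>\<psi> i x. \<psi> \<in> homeos \<Longrightarrow> homeo_dist d \<phi> \<psi> < r \<Longrightarrow> i \<in> J \<Longrightarrow> d (orbit \<phi> i x) (orbit \<psi> i x) < s"
    by blast
  obtain g where g: "continuous_on UNIV g" "inj g" "\<And>x. g x \<in> hilbert_cube"
    "\<And>x n. n < m \<Longrightarrow> g x n = f x n"
    using injective_perturbation[OF f_cont f_cube] by metis
  have "\<exists>h\<in>subshift_embeddings. dist h0 h < e \<and> induced h = \<psi>"
    if \<psi>: "\<psi> \<in> homeos" and close: "homeo_dist d \<phi> \<psi> < r" for \<psi>
  proof -
    obtain h where h: "h \<in> subshift_embeddings" "induced h = \<psi>" "\<And>x i. h x i = g (orbit \<psi> i x)"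
      using itinerary_embedding[OF \<psi> g(1-3)] by metis
    have "dist (h0 x) (h x) < e / 2" for x
    proof (rule J\<eta>, intro ballI allI impI)
      fix i n assume i: "i \<in> J" and n: "n < m"
      have "\<bar>f (orbit \<phi> i x) n - f (orbit \<psi> i x) n\<bar> \<le> v (orbit \<phi> i x, orbit \<psi> i x)"
        unfolding v_def fst_conv snd_conv by (rule member_le_sum) (use n in auto)
      also have "\<dots> < \<eta>" by (rule s(2)) (rule r(2)[OF \<psi> close i])
      finally show "\<bar>h0 x i n - h x i n\<bar> < \<eta>" using orbit_f h(3) g(4)[OF n] by simp
    qed
    then have "dist h0 h \<le> e / 2" by (intro dist_bound less_imp_le)
    then have "dist h0 h < e" using e by linarith
    then show ?thesis using h(1,2) by blast
  qed
  then show ?thesis using r(1) unfolding \<phi>_def by blast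
qed

text \<open>
  The itineraries under a continuous injection of the Cantor set into the Hilbert cube form an
  embedding.
\<close>
lemma every_homeo_induced:
  assumes "\<psi> \<in> homeos"
  obtains h where "h \<in> subshift_embeddings" "induced h = \<psi>"
proof -
  have "continuous_on UNIV (\<lambda>x :: nat \<Rightarrow> bool. \<lambda>n :: nat. 0 :: real)" by simp
  moreover have "(\<lambda>n :: nat. 0 :: real) \<in> hilbert_cube" unfolding hilbert_cube_def by simp
  ultimately obtain g :: "(nat \<Rightarrow> bool) \<Rightarrow> nat \<Rightarrow> real"
    where "continuous_on UNIV g" "inj g" "\<And>x. g x \<in> hilbert_cube"
    using injective_perturbation[of "\<lambda>x n. 0" 0] by metis
  then show ?thesis using itinerary_embedding[OF assms] that by metis
qed

section \<open>The subshift depends openly on the embedding\<close>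

lemma infdist_le_hausdorff_dist:
  fixes A B :: "point set"
  assumes "a \<in> A" "B \<noteq> {}"
  shows "infdist a B \<le> hausdorff_dist A B"
proof -
  obtain b where b: "b \<in> B" using assms(2) by blast
  have "bdd_above ((\<lambda>a. infdist a B) ` A)"
    by (rule bdd_aboveI2[of _ _ 2]) (use infdist_le[OF b] dist_point_le order_trans in blast)
  then have "infdist a B \<le> (SUP a\<in>A. infdist a B)" by (rule cSUP_upper[OF assms(1)])
  then show ?thesis using assms unfolding hausdorff_dist_def by auto
qed

lemma hausdorff_dist_commute: "hausdorff_dist A B = hausdorff_dist B A"
  unfolding hausdorff_dist_def by (simp add: max.commute disj_commute)

lemma hausdorff_dist_less_obtain:
  fixes A B :: "point set"
  assumes "hausdorff_dist A B < r" "a \<in> A" "B \<noteq> {}"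
  obtains b where "b \<in> B" "dist a b < r"
proof -
  have "(INF b\<in>B. dist a b) < r"
    using infdist_le_hausdorff_dist[OF assms(2,3)] assms(1) infdist_notempty[OF assms(3), of a] by simp
  then obtain b where "b \<in> B" "dist a b < r"
    using cInf_lessD[of "dist a ` B" r] assms(3) by blast
  then show ?thesis by (rule that)
qed

lemma hausdorff_dist_range_le:
  fixes h k :: "'a :: topological_space \<Rightarrow>\<^sub>C 'b :: metric_space"
  shows "hausdorff_dist (range (apply_bcontfun h)) (range (apply_bcontfun k)) \<le> dist h k"
proof -
  have 1: "(SUP a\<in>range (apply_bcontfun h). infdist a (range (apply_bcontfun k))) \<le> dist h k"
    for h k :: "'a \<Rightarrow>\<^sub>C 'b"
  proof (rule cSUP_least)
    fix a assume "a \<in> range (apply_bcontfun h)"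
    then obtain x where "a = h x" by blast
    then show "infdist a (range (apply_bcontfun k)) \<le> dist h k"
      using infdist_le2[of "k x" "range (apply_bcontfun k)" a] dist_bounded[of h x k] by simp
  qed simp
  show ?thesis
    unfolding hausdorff_dist_def using 1[of h k] 1[of k h] by (simp add: dist_commute)
qed

text \<open>
  The length \<open>n\<close> is chosen such that \<open>h0\<close> is almost constant on cylinders of length \<open>n\<close>, and \<open>r\<close> such
  that the \<open>r\<close>-neighbourhoods of their images are disjoint. If \<open>Y\<close> is closer than \<open>r\<close> to the range
  of \<open>h0\<close>, then the parts of \<open>Y\<close> in these neighbourhoods form a partition into nonempty open sets. A
  parametrization of \<open>Y\<close> that respects the partition is close to \<open>h0\<close>. It belongs
  to \<open>subshift_embeddings\<close> since its range is a subshift.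
\<close>
lemma range_open:
  assumes h0: "h0 \<in> subshift_embeddings" and e: "e > 0"
  shows "\<exists>r>0. \<forall>Y\<in>subshifts. is_cantor (top_of_set Y) \<longrightarrow>
           hausdorff_dist (range (apply_bcontfun h0)) Y < r \<longrightarrow>
           (\<exists>h\<in>subshift_embeddings. dist h0 h < e \<and> range (apply_bcontfun h) = Y)"
proof -
  have "e / 3 > 0" using e by simp
  from prefix_modulus[OF continuous_on_apply_bcontfun this]
  obtain n where n: "\<And>a b. prefix n a = prefix n b \<Longrightarrow> dist (h0 a) (h0 b) < e / 3" by blast
  from prefix_separation[OF continuous_on_apply_bcontfun subshift_embeddingsD(1)[OF h0], of n]
  obtain s where s: "s > 0" "\<And>a b. prefix n a \<noteq> prefix n b \<Longrightarrow> s \<le> dist (h0 a) (h0 b)" by blast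
  define r where "r = min (s / 2) (e / 3)"
  have r: "r > 0" "r \<le> s / 2" "r \<le> e / 3" using s(1) e unfolding r_def by auto
  have "\<exists>h\<in>subshift_embeddings. dist h0 h < e \<and> range (apply_bcontfun h) = Y"
    if Y: "Y \<in> subshifts" "is_cantor (top_of_set Y)"
      and close: "hausdorff_dist (range (apply_bcontfun h0)) Y < r" for Y
  proof -
    have Y_ne: "Y \<noteq> {}" using Y(1) unfolding subshifts_def by blast
    define V where "V = (\<lambda>w. Y \<inter> (\<Union>x\<in>{x. prefix n x = w}. ball (h0 x) r))"
    have V_mem: "y \<in> V w \<longleftrightarrow> y \<in> Y \<and> (\<exists>x. prefix n x = w \<and> dist (h0 x) y < r)" for y w
      unfolding V_def by auto
    have "\<exists>h. continuous_on UNIV h \<and> inj h \<and> range h = Y \<and> (\<forall>x. h x \<in> V (prefix n x))"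
    proof (rule cantor_adapted_parametrization[OF Y(2)])
      show "openin (top_of_set Y) (V w)" for w
        unfolding V_def by (intro openin_open_Int open_UN ballI open_ball)
      show "V w \<noteq> {}" if w: "length w = n" for w
      proof -
        obtain x where x: "prefix n x = w" using prefix_surj[OF w] by metis
        obtain y where "y \<in> Y" "dist (h0 x) y < r"
          using hausdorff_dist_less_obtain[OF close rangeI Y_ne] by metis
        then have "y \<in> V w" using x unfolding V_mem by blast
        then show ?thesis by blast
      qed
      show "V w \<inter> V w' = {}" if "w \<noteq> w'" for w w'
      proof (rule ccontr)
        assume "V w \<inter> V w' \<noteq> {}"
        then obtain y where "y \<in> V w" "y \<in> V w'" by blast
        then obtain x x' where x: "prefix n x = w" "dist (h0 x) y < r" "prefix n x' = w'" "dist (h0 x') y < r"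
          unfolding V_mem by blast
        then have "dist (h0 x) (h0 x') < s"
          using dist_triangle2[of "h0 x" "h0 x'" y] r(2) by linarith
        moreover have "s \<le> dist (h0 x) (h0 x')" by (rule s(2)) (use x that in simp)
        ultimately show False by simp
      qed
      show "Y \<subseteq> (\<Union>w\<in>{w. length w = n}. V w)"
      proof
        fix y assume y: "y \<in> Y"
        have "hausdorff_dist Y (range (apply_bcontfun h0)) < r"
          using close by (simp add: hausdorff_dist_commute)
        from hausdorff_dist_less_obtain[OF this y] obtain x where "dist y (h0 x) < r" by blast
        then have "y \<in> V (prefix n x)" using y unfolding V_mem by (auto simp: dist_commute)
        then show "y \<in> (\<Union>w\<in>{w. length w = n}. V w)" by (intro UN_I[of "prefix n x"]) simp
      qed
    qed
    then obtain h' where h': "continuous_on UNIV h'" "inj h'" "range h' = Y" "\<And>x. h' x \<in> V (prefix n x)"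
      by blast
    obtain h :: "(nat \<Rightarrow> bool) \<Rightarrow>\<^sub>C point" where h: "apply_bcontfun h = h'"
      using bcontfun_of_continuous[OF h'(1)] by metis
    have "h \<in> subshift_embeddings"
      by (rule subshift_embeddingI) (use h h' Y(1) in auto)
    moreover have "dist (h0 x) (h x) \<le> 2 * e / 3" for x
    proof -
      obtain x' where x': "prefix n x' = prefix n x" "dist (h0 x') (h x) < r"
        using h'(4)[of x] unfolding h V_mem by blast
      then show ?thesis
        using n[OF x'(1)] dist_triangle3[of "h0 x" "h x" "h0 x'"] r(3) by linarith
    qed
    then have "dist h0 h \<le> 2 * e / 3" by (rule dist_bound)
    then have "dist h0 h < e" using e by simp
    ultimately show ?thesis using h h'(3) by blast
  qed
  then show ?thesis using r(1) by blast
qed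

lemma range_is_cantor:
  assumes "h \<in> subshift_embeddings"
  shows "homeomorphic_map cantor_space (top_of_set (range (apply_bcontfun h))) h"
    and "is_cantor (top_of_set (range (apply_bcontfun h)))"
proof -
  have "compact_space cantor_space"
    unfolding compact_space_def using compact_UNIV_cantor by simp
  then show *: "homeomorphic_map cantor_space (top_of_set (range (apply_bcontfun h))) h"
    using subshift_embeddingsD(1)[OF assms]
    by (intro continuous_imp_homeomorphic_map)
      (auto simp: continuous_map_in_subtopology intro: Hausdorff_space_subtopology)
  then show "is_cantor (top_of_set (range (apply_bcontfun h)))"
    unfolding is_cantor_def using homeomorphic_space homeomorphic_space_sym by blast
qed

lemma cantor_subshift_is_range:
  assumes "Y \<in> subshifts" "is_cantor (top_of_set Y)"
  obtains h where "h \<in> subshift_embeddings" "range (apply_bcontfun h) = Y"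
proof -
  obtain k where k: "homeomorphic_map cantor_space (top_of_set Y) k"
    using assms(2) homeomorphic_space_sym unfolding is_cantor_def homeomorphic_space by blast
  have "continuous_on UNIV k" and k_inj: "inj k" and k_range: "range k = Y"
    using homeomorphic_imp_continuous_map[OF k] homeomorphic_imp_injective_map[OF k]
      homeomorphic_imp_surjective_map[OF k] by (auto simp: continuous_map_in_subtopology)
  then obtain h :: "(nat \<Rightarrow> bool) \<Rightarrow>\<^sub>C point" where h: "apply_bcontfun h = k"
    using bcontfun_of_continuous by metis
  have "h \<in> subshift_embeddings"
    by (rule subshift_embeddingI) (use h k_inj k_range assms(1) in auto)
  then show ?thesis using that h k_range by blast
qed

section \<open>Transfer of properties\<close>

lemma tds_isomorphic_trans:
  assumes "tds_isomorphic X T Y S" "tds_isomorphic Y S Z R"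
  shows "tds_isomorphic X T Z R"
proof -
  obtain h where h: "homeomorphic_map X Y h" "\<And>x. x \<in> topspace X \<Longrightarrow> h (T x) = S (h x)"
    using assms(1) unfolding tds_isomorphic_def by blast
  obtain k where k: "homeomorphic_map Y Z k" "\<And>y. y \<in> topspace Y \<Longrightarrow> k (S y) = R (k y)"
    using assms(2) unfolding tds_isomorphic_def by blast
  have "h x \<in> topspace Y" if "x \<in> topspace X" for x
    using homeomorphic_imp_surjective_map[OF h(1)] that by blast
  then have "(k \<circ> h) (T x) = R ((k \<circ> h) x)" if "x \<in> topspace X" for x
    using that h(2) k(2) by simp
  then show ?thesis
    unfolding tds_isomorphic_def using homeomorphic_map_compose[OF h(1) k(1)] by blast
qed

lemma has_property_isomorphic:
  assumes X: "is_tds X T" and Y: "is_tds Y S" and iso: "tds_isomorphic X T Y S"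
  shows "has_property X T P \<longleftrightarrow> has_property Y S P"
proof -
  have "tds_isomorphic X T Z R \<longleftrightarrow> tds_isomorphic Y S Z R" for Z :: "point topology" and R
    using tds_isomorphic_trans[OF iso] tds_isomorphic_trans[OF tds_isomorphic_sym[OF X iso]] by blast
  then show ?thesis using X Y unfolding has_property_def by (simp add: case_prod_unfold)
qed

lemma is_tds_cantor:
  assumes "compatible_metric d" "\<psi> \<in> homeos"
  shows "is_tds cantor_space \<psi>"
proof -
  have "metrizable_space cantor_space"
    using assms(1) Metric_space.metrizable_space_mtopology unfolding compatible_metric_def by metis
  then show ?thesis
    using assms(2) compact_UNIV_cantor unfolding is_tds_def homeos_def compact_space_def by simp
qed

lemma is_tds_subshift:
  assumes Y: "Y \<in> subshifts"
  shows "is_tds (top_of_set Y) shift"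
proof -
  have Y': "Y \<noteq> {}" "closed Y" "Y \<subseteq> cube" "shift ` Y = Y"
    using Y unfolding subshifts_def cube_def by auto
  have "compact Y" using compact_Int_closed[OF compact_cube Y'(2)] Y'(3) by (simp add: Int_absorb1)
  then have "compact_space (top_of_set Y)" by (simp add: compact_space_subtopology)
  moreover have "unshift y \<in> Y" if "y \<in> Y" for y
  proof -
    obtain z where "z \<in> Y" "y = shift z" using Y'(4) \<open>y \<in> Y\<close> by blast
    then show ?thesis by simp
  qed
  then have "homeomorphic_maps (top_of_set Y) (top_of_set Y) shift unshift"
    unfolding homeomorphic_maps_def using Y'(4) continuous_on_shift[of Y] continuous_on_unshift[of Y]
    by (auto simp: continuous_map_in_subtopology)
  then have "homeomorphic_map (top_of_set Y) (top_of_set Y) shift"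
    unfolding homeomorphic_map_maps by blast
  moreover have "metrizable_space (top_of_set Y)"
    by (intro metrizable_space_subtopology metrizable_space_euclidean)
  ultimately show ?thesis unfolding is_tds_def using Y'(1) by simp
qed

text \<open>
  The embedding itself is an isomorphism between the two systems.
\<close>
lemma property_transfer:
  assumes d: "compatible_metric d" and h: "h \<in> subshift_embeddings"
  shows "induced h \<in> homeos_with P \<longleftrightarrow> range (apply_bcontfun h) \<in> subshifts_with P"
proof -
  have "tds_isomorphic cantor_space (induced h) (top_of_set (range (apply_bcontfun h))) shift"
    unfolding tds_isomorphic_def using range_is_cantor(1)[OF h] apply_induced[OF h] by blast
  from has_property_isomorphic[OF is_tds_cantor[OF d induced_homeo[OF h]]
      is_tds_subshift[OF range_subshift_embedding[OF h]] this]
  show ?thesis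
    unfolding homeos_with_def subshifts_with_def
    using induced_homeo[OF h] range_subshift_embedding[OF h] by simp
qed

lemma homeos_with_mono: "Q \<subseteq> P \<Longrightarrow> homeos_with Q \<subseteq> homeos_with P"
  unfolding homeos_with_def has_property_def by blast

lemma subshifts_with_mono: "Q \<subseteq> P \<Longrightarrow> subshifts_with Q \<subseteq> subshifts_with P"
  unfolding subshifts_with_def has_property_def by blast

lemma is_cantor_subshift_with:
  assumes "\<forall>(X, T)\<in>Q. is_cantor X" and "Y \<in> subshifts_with Q"
  shows "is_cantor (top_of_set Y)"
proof -
  obtain Z R where Z: "(Z, R) \<in> Q" "tds_isomorphic (top_of_set Y) shift Z R"
    using assms(2) unfolding subshifts_with_def has_property_def by blast
  then have "top_of_set Y homeomorphic_space Z"
    unfolding tds_isomorphic_def homeomorphic_space by blast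
  moreover have "Z homeomorphic_space cantor_space" using assms(1) Z(1) unfolding is_cantor_def by blast
  ultimately show ?thesis unfolding is_cantor_def by (rule homeomorphic_space_trans)
qed

section \<open>Density and residuality along the two maps\<close>

text \<open>
  The openness condition asks only points of the image to be lifted; the balls of the radii \<open>r\<close> then
  form the open set whose trace is the image.
\<close>
lemma dense_open_map_metricI:
  fixes f :: "'a :: metric_space \<Rightarrow> 'b"
  assumes M: "Metric_space M \<delta>" and S: "S \<subseteq> M" and fS: "f ` E \<subseteq> S"
    and cont: "\<And>x e. x \<in> E \<Longrightarrow> e > 0 \<Longrightarrow> \<exists>r>0. \<forall>y\<in>E. dist x y < r \<longrightarrow> \<delta> (f x) (f y) < e"
    and opn: "\<And>x e. x \<in> E \<Longrightarrow> e > 0 \<Longrightarrow>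
        \<exists>r>0. \<forall>z\<in>f ` E. \<delta> (f x) z < r \<longrightarrow> (\<exists>y\<in>E. dist x y < e \<and> f y = z)"
    and dense: "dense_in (subtopology (Metric_space.mtopology M \<delta>) S) (f ` E)"
  shows "dense_open_map (top_of_set E) (subtopology (Metric_space.mtopology M \<delta>) S) f"
proof -
  interpret Metric_space M \<delta> by (rule M)
  have fM: "f x \<in> M" if "x \<in> E" for x using that fS S by blast
  show ?thesis
  proof
    have "continuous_map (top_of_set E) mtopology f"
      unfolding continuous_map_to_metric
    proof (intro ballI allI impI)
      fix x and e :: real assume "x \<in> topspace (top_of_set E)" and e: "e > 0"
      then have x: "x \<in> E" by simp
      obtain r where r: "r > 0" "\<forall>y\<in>E. dist x y < r \<longrightarrow> \<delta> (f x) (f y) < e" using cont[OF x e] by blast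
      have "openin (top_of_set E) (E \<inter> ball x r)" by (simp add: openin_open_Int)
      moreover have "x \<in> E \<inter> ball x r" using x r(1) by simp
      moreover have "\<forall>y\<in>E \<inter> ball x r. f y \<in> mball (f x) e" using r(2) fM x by simp
      ultimately show "\<exists>U. openin (top_of_set E) U \<and> x \<in> U \<and> (\<forall>y\<in>U. f y \<in> mball (f x) e)" by blast
    qed
    then show "continuous_map (top_of_set E) (subtopology mtopology S) f"
      using fS by (auto simp: continuous_map_in_subtopology)
    show "subtopology mtopology S closure_of f ` topspace (top_of_set E) = topspace (subtopology mtopology S)"
      using dense unfolding dense_in_def by simp
  next
    fix U assume U: "openin (top_of_set E) U"
    then have UE: "U \<subseteq> E" using openin_subset by fastforce
    have "\<exists>r>0. \<forall>z\<in>f ` E. \<delta> (f x) z < r \<longrightarrow> z \<in> f ` U" if x: "x \<in> U" for x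
    proof -
      obtain e where e: "e > 0" "ball x e \<inter> E \<subseteq> U"
        using U x unfolding openin_contains_ball by blast
      obtain r where r: "r > 0" "\<forall>z\<in>f ` E. \<delta> (f x) z < r \<longrightarrow> (\<exists>y\<in>E. dist x y < e \<and> f y = z)"
        using opn[OF _ e(1)] x UE by blast
      have "z \<in> f ` U" if z: "z \<in> f ` E" "\<delta> (f x) z < r" for z
      proof -
        obtain y where y: "y \<in> E" "dist x y < e" "f y = z" using r(2) z by blast
        then have "y \<in> U" using e(2) by auto
        then show ?thesis using y(3) by blast
      qed
      then show ?thesis using r(1) by blast
    qed
    then obtain \<rho> where \<rho>: "\<And>x. x \<in> U \<Longrightarrow> \<rho> x > 0"
      "\<And>x z. x \<in> U \<Longrightarrow> z \<in> f ` E \<Longrightarrow> \<delta> (f x) z < \<rho> x \<Longrightarrow> z \<in> f ` U"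
      by metis
    define W where "W = (\<Union>x\<in>U. mball (f x) (\<rho> x)) \<inter> S"
    have "openin mtopology (\<Union>x\<in>U. mball (f x) (\<rho> x))" by (intro openin_Union) auto
    then have "openin (subtopology mtopology S) W" unfolding W_def by (rule openin_subtopology_Int)
    moreover have "W \<inter> f ` topspace (top_of_set E) = f ` U"
    proof (intro equalityI subsetI)
      fix z assume "z \<in> W \<inter> f ` topspace (top_of_set E)"
      then obtain x where "x \<in> U" "\<delta> (f x) z < \<rho> x" "z \<in> f ` E" unfolding W_def by auto
      then show "z \<in> f ` U" using \<rho>(2) by blast
    next
      fix z assume "z \<in> f ` U"
      then obtain x where x: "x \<in> U" "z = f x" by blast
      then have "z \<in> mball (f x) (\<rho> x)" using fM UE \<rho>(1) by auto
      then show "z \<in> W \<inter> f ` topspace (top_of_set E)" unfolding W_def using x UE fS by auto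
    qed
    ultimately show "\<exists>W. openin (subtopology mtopology S) W \<and> W \<inter> f ` topspace (top_of_set E) = f ` U"
      by blast
  qed
qed

lemma dense_in_topspace: "dense_in X (topspace X)"
  unfolding dense_in_def by simp

lemma image_induced:
  "induced ` {h \<in> subshift_embeddings. induced h \<in> homeos_with P} = homeos_with P"
proof (intro equalityI subsetI)
  fix \<psi> assume \<psi>: "\<psi> \<in> homeos_with P"
  then have "\<psi> \<in> homeos" unfolding homeos_with_def by blast
  then obtain h where "h \<in> subshift_embeddings" "induced h = \<psi>" using every_homeo_induced by blast
  then show "\<psi> \<in> induced ` {h \<in> subshift_embeddings. induced h \<in> homeos_with P}" using \<psi> by blast
qed blast

lemma induced_dense_open_map:
  assumes d: "compatible_metric d"
  shows "dense_open_map (top_of_set {h \<in> subshift_embeddings. induced h \<in> homeos_with P})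
           (subtopology (homeo_topology d) (homeos_with P)) induced"
  unfolding homeo_topology_def
proof (rule dense_open_map_metricI)
  let ?E = "{h \<in> subshift_embeddings. induced h \<in> homeos_with P}"
  interpret Metric_space homeos "homeo_dist d" by (rule Metric_space_homeos[OF d])
  show "Metric_space homeos (homeo_dist d)" by (rule Metric_space_homeos[OF d])
  show sub: "homeos_with P \<subseteq> homeos" unfolding homeos_with_def by blast
  show "induced ` ?E \<subseteq> homeos_with P" by blast
  show "dense_in (subtopology mtopology (homeos_with P)) (induced ` ?E)"
    unfolding image_induced using dense_in_topspace[of "subtopology mtopology (homeos_with P)"] sub
    by (simp add: Int_absorb1)
  fix h and e :: real assume h: "h \<in> ?E" and e: "e > 0"
  show "\<exists>r>0. \<forall>k\<in>?E. dist h k < r \<longrightarrow> homeo_dist d (induced h) (induced k) < e"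
    using induced_continuous[OF d _ e] h by blast
  show "\<exists>r>0. \<forall>\<psi>\<in>induced ` ?E. homeo_dist d (induced h) \<psi> < r \<longrightarrow> (\<exists>k\<in>?E. dist h k < e \<and> induced k = \<psi>)"
  proof -
    obtain r where r: "r > 0" "\<forall>\<psi>\<in>homeos. homeo_dist d (induced h) \<psi> < r \<longrightarrow>
        (\<exists>k\<in>subshift_embeddings. dist h k < e \<and> induced k = \<psi>)"
      using induced_open[OF d _ e] h by blast
    have "\<exists>k\<in>?E. dist h k < e \<and> induced k = \<psi>"
      if \<psi>: "\<psi> \<in> induced ` ?E" "homeo_dist d (induced h) \<psi> < r" for \<psi>
    proof -
      have P: "\<psi> \<in> homeos_with P" using \<psi>(1) by blast
      then obtain k where "k \<in> subshift_embeddings" "dist h k < e" "induced k = \<psi>"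
        using r(2) \<psi>(2) sub by blast
      then show ?thesis using P by blast
    qed
    then show ?thesis using r(1) by blast
  qed
qed

lemma image_range:
  assumes d: "compatible_metric d"
  shows "(\<lambda>h. range (apply_bcontfun h)) ` {h \<in> subshift_embeddings. induced h \<in> homeos_with P} =
    {Y \<in> subshifts_with P. is_cantor (top_of_set Y)}"
proof (intro equalityI subsetI)
  fix Y assume "Y \<in> (\<lambda>h. range (apply_bcontfun h)) ` {h \<in> subshift_embeddings. induced h \<in> homeos_with P}"
  then show "Y \<in> {Y \<in> subshifts_with P. is_cantor (top_of_set Y)}"
    using property_transfer[OF d] range_is_cantor(2) by blast
next
  fix Y assume Y: "Y \<in> {Y \<in> subshifts_with P. is_cantor (top_of_set Y)}"
  then have "Y \<in> subshifts" "is_cantor (top_of_set Y)" unfolding subshifts_with_def by auto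
  then obtain h where h: "h \<in> subshift_embeddings" "range (apply_bcontfun h) = Y"
    using cantor_subshift_is_range by blast
  then have "induced h \<in> homeos_with P" using property_transfer[OF d h(1)] Y by simp
  then show "Y \<in> (\<lambda>h. range (apply_bcontfun h)) ` {h \<in> subshift_embeddings. induced h \<in> homeos_with P}"
    using h by blast
qed

lemma range_dense_open_map:
  assumes d: "compatible_metric d"
    and dense: "dense_in (subtopology subshift_topology (subshifts_with P))
       {Y \<in> subshifts_with P. is_cantor (top_of_set Y)}"
  shows "dense_open_map (top_of_set {h \<in> subshift_embeddings. induced h \<in> homeos_with P})
           (subtopology subshift_topology (subshifts_with P)) (\<lambda>h. range (apply_bcontfun h))"
  unfolding subshift_topology_def
proof (rule dense_open_map_metricI)
  let ?E = "{h \<in> subshift_embeddings. induced h \<in> homeos_with P}"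
  let ?f = "\<lambda>h :: (nat \<Rightarrow> bool) \<Rightarrow>\<^sub>C point. range (apply_bcontfun h)"
  show "Metric_space subshifts hausdorff_dist" by (rule Metric_space_subshifts)
  show sub: "subshifts_with P \<subseteq> subshifts" unfolding subshifts_with_def by blast
  show "?f ` ?E \<subseteq> subshifts_with P" unfolding image_range[OF d] by blast
  show "dense_in (subtopology (Metric_space.mtopology subshifts hausdorff_dist) (subshifts_with P)) (?f ` ?E)"
    unfolding image_range[OF d] using dense unfolding subshift_topology_def .
  fix h and e :: real assume h: "h \<in> ?E" and e: "e > 0"
  show "\<exists>r>0. \<forall>k\<in>?E. dist h k < r \<longrightarrow> hausdorff_dist (?f h) (?f k) < e"
    using hausdorff_dist_range_le le_less_trans e by blast
  show "\<exists>r>0. \<forall>Y\<in>?f ` ?E. hausdorff_dist (?f h) Y < r \<longrightarrow> (\<exists>k\<in>?E. dist h k < e \<and> ?f k = Y)"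
  proof -
    obtain r where r: "r > 0" "\<forall>Y\<in>subshifts. is_cantor (top_of_set Y) \<longrightarrow> hausdorff_dist (?f h) Y < r \<longrightarrow>
        (\<exists>k\<in>subshift_embeddings. dist h k < e \<and> ?f k = Y)"
      using range_open[OF _ e] h by blast
    have "\<exists>k\<in>?E. dist h k < e \<and> ?f k = Y"
      if Y: "Y \<in> ?f ` ?E" "hausdorff_dist (?f h) Y < r" for Y
    proof -
      have P: "Y \<in> subshifts_with P" "is_cantor (top_of_set Y)" using Y(1) unfolding image_range[OF d] by auto
      then obtain k where k: "k \<in> subshift_embeddings" "dist h k < e" "?f k = Y"
        using r(2) Y(2) sub by blast
      then have "induced k \<in> homeos_with P" using property_transfer[OF d k(1)] P(1) by simp
      then show ?thesis using k by blast
    qed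
    then show ?thesis using r(1) by blast
  qed
qed

lemma completely_metrizable_embeddings_with:
  assumes d: "compatible_metric d" and G: "gdelta_in (homeo_topology d) (homeos_with P)"
  shows "completely_metrizable_space (top_of_set {h \<in> subshift_embeddings. induced h \<in> homeos_with P})"
proof -
  interpret Metric_space homeos "homeo_dist d" by (rule Metric_space_homeos[OF d])
  have "continuous_map (top_of_set subshift_embeddings) (homeo_topology d) induced"
    unfolding homeo_topology_def continuous_map_to_metric
  proof (intro ballI allI impI)
    fix h and e :: real assume "h \<in> topspace (top_of_set subshift_embeddings)" and e: "e > 0"
    then have h: "h \<in> subshift_embeddings" by simp
    obtain r where r: "r > 0" "\<forall>k\<in>subshift_embeddings. dist h k < r \<longrightarrow> homeo_dist d (induced h) (induced k) < e"
      using induced_continuous[OF d h e] by blast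
    have "openin (top_of_set subshift_embeddings) (subshift_embeddings \<inter> ball h r)"
      by (simp add: openin_open_Int)
    moreover have "h \<in> subshift_embeddings \<inter> ball h r" using h r(1) by simp
    moreover have "\<forall>k\<in>subshift_embeddings \<inter> ball h r. induced k \<in> mball (induced h) e"
      using r(2) h induced_homeo by simp
    ultimately show "\<exists>U. openin (top_of_set subshift_embeddings) U \<and> h \<in> U \<and>
        (\<forall>k\<in>U. induced k \<in> mball (induced h) e)"
      by blast
  qed
  note pre = openin_continuous_map_preimage[OF this]
  obtain C where C: "\<And>n::nat. openin (homeo_topology d) (C n)" "\<Inter>(range C) = homeos_with P"
    using G unfolding gdelta_in_descending by blast
  have "gdelta_in (top_of_set subshift_embeddings) (\<Inter>n. {h \<in> subshift_embeddings. induced h \<in> C n})"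
    using pre[OF C(1)] by (intro gdelta_in_Inter) (auto intro: open_imp_gdelta_in)
  moreover have "(\<Inter>n. {h \<in> subshift_embeddings. induced h \<in> C n}) =
      {h \<in> subshift_embeddings. induced h \<in> homeos_with P}"
    unfolding C(2)[symmetric] by blast
  ultimately have "gdelta_in euclidean {h \<in> subshift_embeddings. induced h \<in> homeos_with P}"
    using gdelta_in_gdelta_subtopology[OF gdelta_subshift_embeddings] by simp
  then show ?thesis by (rule completely_metrizable_space_gdelta_in[OF completely_metrizable_bcontfun])
qed

theorem theorem1p3:
  fixes d :: "(nat \<Rightarrow> bool) \<Rightarrow> (nat \<Rightarrow> bool) \<Rightarrow> real"
    and P Q :: sys_class
  assumes "compatible_metric d"
    and "dynamical_property P"
    and "gdelta_in (homeo_topology d) (homeos_with P)"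
    and "gdelta_in subshift_topology (subshifts_with P)"
    and "dense_in (subtopology subshift_topology (subshifts_with P))
           {X \<in> subshifts_with P. is_cantor (top_of_set X)}"
    and "dynamical_property Q"
    and "Q \<subseteq> P"
  shows "(residual_in (subtopology (homeo_topology d) (homeos_with P)) (homeos_with Q) \<longleftrightarrow>
            residual_in (subtopology subshift_topology (subshifts_with P)) (subshifts_with Q)) \<and>
         ((\<forall>(X, T)\<in>Q. is_cantor X) \<longrightarrow>
            (dense_in (subtopology (homeo_topology d) (homeos_with P)) (homeos_with Q) \<longleftrightarrow>
             dense_in (subtopology subshift_topology (subshifts_with P)) (subshifts_with Q)))"
proof -
  note d = assms(1)
  define E where "E = {h \<in> subshift_embeddings. induced h \<in> homeos_with P}"
  let ?f = "\<lambda>h :: (nat \<Rightarrow> bool) \<Rightarrow>\<^sub>C point. range (apply_bcontfun h)"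
  interpret I: dense_open_map "top_of_set E" "subtopology (homeo_topology d) (homeos_with P)" induced
    unfolding E_def by (rule induced_dense_open_map[OF d])
  interpret R: dense_open_map "top_of_set E" "subtopology subshift_topology (subshifts_with P)" ?f
    unfolding E_def by (rule range_dense_open_map[OF d assms(5)])
  have E: "completely_metrizable_space (top_of_set E)"
    unfolding E_def by (rule completely_metrizable_embeddings_with[OF d assms(3)])
  have H: "Hausdorff_space (subtopology (homeo_topology d) (homeos_with P))"
    unfolding homeo_topology_def
    by (intro Hausdorff_space_subtopology Metric_space.Hausdorff_space_mtopology Metric_space_homeos d)
  have S: "Hausdorff_space (subtopology subshift_topology (subshifts_with P))"
    unfolding subshift_topology_def
    by (intro Hausdorff_space_subtopology Metric_space.Hausdorff_space_mtopology Metric_space_subshifts)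
  have HQ: "homeos_with Q \<subseteq> induced ` topspace (top_of_set E)"
    using homeos_with_mono[OF assms(7)] unfolding E_def by (simp add: image_induced)
  have SQ: "subshifts_with Q \<subseteq> topspace (subtopology subshift_topology (subshifts_with P))"
  proof -
    interpret Metric_space subshifts hausdorff_dist by (rule Metric_space_subshifts)
    show ?thesis
      using subshifts_with_mono[OF assms(7)] unfolding subshift_topology_def subshifts_with_def by auto
  qed
  \<comment> \<open>The two properties cut out the same set of embeddings, so each equivalence goes through this set.\<close>
  have same: "{h \<in> topspace (top_of_set E). induced h \<in> homeos_with Q} =
      {h \<in> topspace (top_of_set E). ?f h \<in> subshifts_with Q}"
    unfolding E_def using property_transfer[OF d, of _ Q] by auto
  show ?thesis
  proof (intro conjI impI)
    show "residual_in (subtopology (homeo_topology d) (homeos_with P)) (homeos_with Q) \<longleftrightarrow>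
        residual_in (subtopology subshift_topology (subshifts_with P)) (subshifts_with Q)"
      using I.residual_preimage[OF E H order_trans[OF HQ I.image_sub]] R.residual_preimage[OF E S SQ]
      unfolding same by simp
    assume "\<forall>(X, T)\<in>Q. is_cantor X"
    then have "subshifts_with Q \<subseteq> ?f ` topspace (top_of_set E)"
      using is_cantor_subshift_with subshifts_with_mono[OF assms(7)] image_range[OF d, of P]
      unfolding E_def by auto
    from R.dense_in_preimage[OF this] I.dense_in_preimage[OF HQ]
    show "dense_in (subtopology (homeo_topology d) (homeos_with P)) (homeos_with Q) \<longleftrightarrow>
        dense_in (subtopology subshift_topology (subshifts_with P)) (subshifts_with Q)"
      unfolding same by simp
  qed
qed

end
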